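(* Let $f:\mathbb N_{\geq1}\to\mathbb N_{\geq1}$ be a fixed computable function with $f(m)\geq m$ for all $m$, and let $\operatorname{Solve}_f$ be the represented problem $(A,b)\mapsto A^{-1}b$ on $\Omega_f$, with coordinatewise product-Cauchy input names and norm-Cauchy output names. Then $$\operatorname{Solve}_f\equiv_{\mathrm W}\operatorname{Lim},\qquad \operatorname{SCI}^{\lim}_{\mathrm{Comp}}(P_f)=\operatorname{rk}_{\lim}(\operatorname{Solve}_f)=1.$$
   Context: Conventions. $\mathbb N=\{0,1,2,\dots\}$; computable codings of rationals by naturals and a computable bijective pairing $\langle\cdot,\cdot\rangle:\mathbb N^2\to\mathbb N$ are fixed. Computability of partial functionals on Baire space $\mathbb N^{\mathbb N}$ is in the Type-2 sense. A representation of $X$ is a partial surjection $\delta_X:\subseteq\mathbb N^{\mathbb N}\to X$; $p$ is a name of $\delta_X(p)$. Cauchy representation of reals: $\rho(p)=x$ iff $|r_j-x|\leq2^{-j}$ for all $j$, where $r_j$ is the rational coded by $p(j)$; complex numbers are named by names of real and imaginary parts; sequences are named by uniform sequences of names. For represented problems $f:\subseteq X\rightrightarrows Y$, $g:\subseteq U\rightrightarrows V$: a realizer of $g$ is a single-valued partial map on names sending each name of each $u\in\operatorname{dom}(g)$ to a name of an element of $g(u)$. $f\leq_{\mathrm W}g$ means there are computable partial functionals $K,H$ such that for every realizer $G$ of $g$, $p\mapsto H(p,G(K(p)))$ realizes $f$. $\equiv_{\mathrm W}$ is mutual reducibility. $\operatorname{Lim}:\subseteq\mathbb N^{\mathbb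 N}\to\mathbb N^{\mathbb N}$ is $\operatorname{Lim}(P)(j)=\lim_{s\to\infty}P(\langle s,j\rangle)$, with domain those $P$ for which every column $s\mapsto P(\langle s,j\rangle)$ is eventually constant. $\operatorname{Lim}^{(0)}=\mathrm{id}$, $\operatorname{Lim}^{(k+1)}=\operatorname{Lim}\circ\operatorname{Lim}^{(k)}$, and $\operatorname{rk}_{\lim}(f)=\min\{k:f\leq_{\mathrm W}\operatorname{Lim}^{(k)}\}$ ($\infty$ if none). The problem. $H=\ell^2(\mathbb N_{\geq1};\mathbb C)$ with standard basis $(e_j)_{j\geq1}$; $P_m$ is the orthogonal projection onto $\operatorname{span}\{e_1,\dots,e_m\}$. For bounded $A$ on $H$ put $D_{f,m}(A)=\max\{\|(I-P_{f(m)})AP_m\|,\|P_mA(I-P_{f(m)})\|\}$, and $$\Omega_f=\{A\in\mathcal B(H):A\text{ has a bounded everywhere-defined inverse and }D_{f,m}(A)\to0\ (m\to\infty)\}\times H.$$ $P_f$ is the SCI problem with target $\Xi_f(A,b)=A^{-1}b\in H$ (norm metric) and evaluations $\lambda^A_{ij}(A,b)=\langle Ae_j,e_i\rangle$, $\lambda^b_i(A,b)=\langle b,e_i\rangle$ ($i,j\geq1$). $\operatorname{Solve}_f$ is the represented problem whose inputs are named by product Cauchy names of all these individual coordinates (restricted to elements of $\Omega_f$; no norm bounds or moduli supplied). Output representation $\delta_H$: for a fixed effective enumeration $(v_j)$ of finitely supported rational complex vectors, $\delta_H(q)=x$ iff $\|v_{q(k)}-x\|\leq2^{-k}$ for all $k\in\mathbb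 N$. Pure height. $\operatorname{SCI}^{\lim}_{\mathrm{Comp}}(P_f)$ is the least $k\in\mathbb N$ for which there is a computable partial functional $K$ on $\mathbb N^{\mathbb N}$ such that, for every input name $p$ of every $(A,b)\in\Omega_f$, $\operatorname{Lim}^{(k)}(K(p))$ is defined and is a $\delta_H$-name of $A^{-1}b$ ($\infty$ if no such $k$). *)

theory Defs
  imports
    "HOL-Analysis.Analysis"
    "HOL-Library.Nat_Bijection"
    "HOL-Library.Countable"
    "HOL-Library.Extended_Nat"
begin

section \<open>Type-2 computability on Baire space\<close>

type_synonym baire = "nat \<Rightarrow> nat"

text \<open>Kleene's \<open>\<mu>\<close>-recursive programs with an oracle \<open>p\<close>, queried by \<open>Orac\<close>.
  A Type-2 machine computing \<open>p \<mapsto> q\<close> is rendered as a program that computes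
  \<open>n \<mapsto> q n\<close> relative to \<open>p\<close>.\<close>

datatype recf =
    Zero
  | Succ
  | Proj nat
  | Orac
  | Comp recf "recf list"
  | Prec recf recf
  | Mu recf

text \<open>\<open>run e p xs\<close> is the value of program \<open>e\<close> with oracle \<open>p\<close> on arguments \<open>xs\<close>, and \<open>None\<close> if
  the computation diverges (or the arity is wrong). The minimisation \<open>Mu g\<close> diverges if \<open>g\<close> diverges
  before its first zero.\<close>

fun run :: "recf \<Rightarrow> baire \<Rightarrow> nat list \<Rightarrow> nat option" where
  "run Zero p xs = Some 0"
| "run Succ p xs = (case xs of [] \<Rightarrow> None | x # _ \<Rightarrow> Some (Suc x))"
| "run (Proj i) p xs = (if i < length xs then Some (xs ! i) else None)"
| "run Orac p xs = (case xs of [] \<Rightarrow> None | x # _ \<Rightarrow> Some (p x))"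
| "run (Comp g hs) p xs =
    (let ys = map (\<lambda>h. run h p xs) hs
     in if None \<in> set ys then None else run g p (map the ys))"
| "run (Prec g h) p xs =
    (case xs of [] \<Rightarrow> None
     | n # zs \<Rightarrow>
         rec_nat (run g p zs) (\<lambda>k r. Option.bind r (\<lambda>y. run h p (k # y # zs))) n)"
| "run (Mu g) p xs =
    (if \<exists>n. run g p (n # xs) = Some 0 \<and> (\<forall>k<n. run g p (k # xs) \<noteq> None)
     then Some (LEAST n. run g p (n # xs) = Some 0) else None)"

definition functional :: "recf \<Rightarrow> baire \<Rightarrow> baire option" where
  "functional e p =
    (if \<forall>n. run e p [n] \<noteq> None then Some (\<lambda>n. the (run e p [n])) else None)"

definition computable :: "(baire \<Rightarrow> baire option) \<Rightarrow> bool" where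
  "computable F \<longleftrightarrow> (\<exists>e. F = functional e)"

text \<open>Pairs of points of Baire space are interleaved.\<close>

definition join :: "baire \<Rightarrow> baire \<Rightarrow> baire" where
  "join p q = (\<lambda>n. if even n then p (n div 2) else q (n div 2))"

definition evens :: "baire \<Rightarrow> baire" where
  "evens p = (\<lambda>n. p (2 * n))"

definition odds :: "baire \<Rightarrow> baire" where
  "odds p = (\<lambda>n. p (2 * n + 1))"

definition computable2 :: "(baire \<Rightarrow> baire \<Rightarrow> baire option) \<Rightarrow> bool" where
  "computable2 H \<longleftrightarrow> (\<exists>F. computable F \<and> H = (\<lambda>p q. F (join p q)))"

text \<open>Ordinary computability of a number function on a set of arguments: the program has to
  give the right value whatever its oracle is, so that the oracle is of no use.\<close>

definition computable_nat_on :: "nat set \<Rightarrow> (nat \<Rightarrow> nat) \<Rightarrow> bool" where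
  "computable_nat_on S f \<longleftrightarrow> (\<exists>e. \<forall>p. \<forall>n\<in>S. run e p [n] = Some (f n))"


section \<open>Represented problems and Weihrauch reducibility\<close>

text \<open>A representation is given by its graph: \<open>\<delta> p x\<close> means that \<open>p\<close> is a name of \<open>x\<close>.\<close>

type_synonym 'a representation = "baire \<Rightarrow> 'a \<Rightarrow> bool"

text \<open>The domain of a problem consists of the inputs that have at least one solution.\<close>

record ('x, 'y) problem =
  in_rep :: "'x representation"
  out_rep :: "'y representation"
  sols :: "'x \<Rightarrow> 'y set"

definition realizes :: "(baire \<Rightarrow> baire option) \<Rightarrow> ('x, 'y) problem \<Rightarrow> bool" where
  "realizes G g \<longleftrightarrow>
    (\<forall>p u. sols g u \<noteq> {} \<and> in_rep g p u \<longrightarrow>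
       (\<exists>q v. G p = Some q \<and> out_rep g q v \<and> v \<in> sols g u))"

definition weihrauch_le :: "('x, 'y) problem \<Rightarrow> ('u, 'v) problem \<Rightarrow> bool"
    (infix "\<le>\<^sub>W" 50) where
  "f \<le>\<^sub>W g \<longleftrightarrow>
    (\<exists>K H. computable K \<and> computable2 H \<and>
      (\<forall>G. realizes G g \<longrightarrow>
         realizes (\<lambda>p. Option.bind (K p) (\<lambda>q. Option.bind (G q) (\<lambda>r. H p r))) f))"

definition weihrauch_equiv :: "('x, 'y) problem \<Rightarrow> ('u, 'v) problem \<Rightarrow> bool"
    (infix "\<equiv>\<^sub>W" 50) where
  "f \<equiv>\<^sub>W g \<longleftrightarrow> f \<le>\<^sub>W g \<and> g \<le>\<^sub>W f"

text \<open>On \<open>nat\<close>, which is discrete, \<open>lim\<close> of an eventually constant sequence is its eventual value.\<close>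

definition Lim_baire :: "baire \<Rightarrow> baire option" where
  "Lim_baire P =
    (if \<forall>j. \<exists>v. \<forall>\<^sub>F s in sequentially. P (prod_encode (s, j)) = v
     then Some (\<lambda>j. lim (\<lambda>s. P (prod_encode (s, j)))) else None)"

fun Lim_pow :: "nat \<Rightarrow> baire \<Rightarrow> baire option" where
  "Lim_pow 0 P = Some P"
| "Lim_pow (Suc k) P = Option.bind (Lim_pow k P) Lim_baire"

definition baire_problem :: "(baire \<Rightarrow> baire option) \<Rightarrow> (baire, baire) problem" where
  "baire_problem F =
    \<lparr>in_rep = (\<lambda>p x. p = x), out_rep = (\<lambda>p x. p = x), sols = (\<lambda>x. set_option (F x))\<rparr>"

text \<open>The infimum of the empty set in \<open>enat\<close> is \<open>\<infinity>\<close>.\<close>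

definition rk_lim :: "('x, 'y) problem \<Rightarrow> enat" where
  "rk_lim f = Inf {enat k |k. f \<le>\<^sub>W baire_problem (Lim_pow k)}"


section \<open>The Hilbert space\<close>

text \<open>Sequences indexed by the positive integers are functions on \<open>nat\<close> vanishing at \<open>0\<close>.\<close>

typedef ell2 = "{x :: nat \<Rightarrow> complex. x 0 = 0 \<and> summable (\<lambda>i. (cmod (x i))\<^sup>2)}"
  morphisms coord Abs_ell2
  by (rule exI[of _ "\<lambda>_. 0"]) simp

lemma coord_0 [simp]: "coord x 0 = 0"
  and coord_summable: "summable (\<lambda>i. (cmod (coord x i))\<^sup>2)"
  using coord[of x] by auto

lemma ell2_eqI: "(\<And>i. coord x i = coord y i) \<Longrightarrow> x = y"
  by (metis coord_inject ext)

lemma ell2_minkowski: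
  fixes x y :: "nat \<Rightarrow> complex"
  assumes x: "summable (\<lambda>i. (cmod (x i))\<^sup>2)" and y: "summable (\<lambda>i. (cmod (y i))\<^sup>2)"
  shows "summable (\<lambda>i. (cmod (x i + y i))\<^sup>2)"
    and "sqrt (\<Sum>i. (cmod (x i + y i))\<^sup>2)
          \<le> sqrt (\<Sum>i. (cmod (x i))\<^sup>2) + sqrt (\<Sum>i. (cmod (y i))\<^sup>2)"
proof -
  let ?X = "\<Sum>i. (cmod (x i))\<^sup>2" and ?Y = "\<Sum>i. (cmod (y i))\<^sup>2"
  have part: "(\<Sum>i<n. (cmod (x i + y i))\<^sup>2) \<le> (sqrt ?X + sqrt ?Y)\<^sup>2" for n
  proof -
    have "L2_set (\<lambda>i. cmod (x i + y i)) {..<n} \<le> L2_set (\<lambda>i. cmod (x i) + cmod (y i)) {..<n}"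
      by (rule L2_set_mono) (auto intro: norm_triangle_ineq)
    also have "\<dots> \<le> L2_set (\<lambda>i. cmod (x i)) {..<n} + L2_set (\<lambda>i. cmod (y i)) {..<n}"
      by (rule L2_set_triangle_ineq)
    also have "\<dots> \<le> sqrt ?X + sqrt ?Y"
      unfolding L2_set_def
      by (intro add_mono real_sqrt_le_mono sum_le_suminf x y) auto
    finally have "sqrt (\<Sum>i<n. (cmod (x i + y i))\<^sup>2) \<le> sqrt ?X + sqrt ?Y"
      by (simp add: L2_set_def)
    then show ?thesis
      by (rule sqrt_le_D)
  qed
  show s: "summable (\<lambda>i. (cmod (x i + y i))\<^sup>2)"
    by (rule bounded_imp_summable[of _ "(sqrt ?X + sqrt ?Y)\<^sup>2"])
       (use part[of "Suc _"] in \<open>auto simp: lessThan_Suc_atMost\<close>)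
  have "(\<Sum>i. (cmod (x i + y i))\<^sup>2) \<le> (sqrt ?X + sqrt ?Y)\<^sup>2"
    by (rule suminf_le_const[OF s part])
  then show "sqrt (\<Sum>i. (cmod (x i + y i))\<^sup>2) \<le> sqrt ?X + sqrt ?Y"
    by (rule real_le_lsqrt[rotated]) (simp add: suminf_nonneg x y)
qed

definition cscale :: "complex \<Rightarrow> ell2 \<Rightarrow> ell2" where
  "cscale c x = Abs_ell2 (\<lambda>i. c * coord x i)"

lemma coord_cscale [simp]: "coord (cscale c x) i = c * coord x i"
  using coord_summable[of x]
  by (simp add: cscale_def Abs_ell2_inverse norm_mult power_mult_distrib summable_mult)

instantiation ell2 :: real_normed_vector
begin

definition "(0 :: ell2) = Abs_ell2 (\<lambda>_. 0)"
definition "x + y = Abs_ell2 (\<lambda>i. coord x i + coord y i)"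
definition "- x = cscale (- 1) x"
definition "(x :: ell2) - y = x + - y"
definition "scaleR r x = cscale (complex_of_real r) x"
definition "norm x = sqrt (\<Sum>i. (cmod (coord x i))\<^sup>2)"
definition "dist x y = norm (x - y :: ell2)"
definition "sgn x = inverse (norm x) *\<^sub>R (x :: ell2)"
definition "(uniformity :: (ell2 \<times> ell2) filter) =
  (INF e\<in>{0<..}. principal {(x, y). dist x y < e})"
definition "open (U :: ell2 set) \<longleftrightarrow>
  (\<forall>x\<in>U. \<forall>\<^sub>F (x', y) in uniformity. x' = x \<longrightarrow> y \<in> U)"

lemma coord_zero [simp]: "coord 0 i = 0"
  by (simp add: zero_ell2_def Abs_ell2_inverse)

lemma coord_plus [simp]: "coord (x + y) i = coord x i + coord y i"
  by (simp add: plus_ell2_def Abs_ell2_inverse ell2_minkowski(1) coord_summable)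

lemma coord_uminus [simp]: "coord (- x) i = - coord x i"
  by (simp add: uminus_ell2_def)

lemma coord_minus [simp]: "coord (x - y) i = coord x i - coord y i"
  by (simp add: minus_ell2_def)

lemma coord_scaleR [simp]: "coord (r *\<^sub>R x) i = complex_of_real r * coord x i"
  by (simp add: scaleR_ell2_def)

instance
proof
  fix x y z :: ell2 and a b :: real
  show "x + y + z = x + (y + z)" "x + y = y + x" "0 + x = x" "- x + x = 0" "x - y = x + - y"
    "a *\<^sub>R (x + y) = a *\<^sub>R x + a *\<^sub>R y" "(a + b) *\<^sub>R x = a *\<^sub>R x + b *\<^sub>R x"
    "a *\<^sub>R b *\<^sub>R x = (a * b) *\<^sub>R x" "1 *\<^sub>R x = x"
    by (rule ell2_eqI, simp add: algebra_simps)+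
  show "dist x y = norm (x - y)" "sgn x = inverse (norm x) *\<^sub>R x"
    by (simp_all add: dist_ell2_def sgn_ell2_def)
  show "(norm x = 0) = (x = 0)"
  proof
    assume "norm x = 0"
    then have "(\<Sum>i. (cmod (coord x i))\<^sup>2) = 0"
      by (simp add: norm_ell2_def)
    then have "\<forall>i. (cmod (coord x i))\<^sup>2 = 0"
      using suminf_eq_zero_iff[OF coord_summable[of x]] by simp
    then show "x = 0"
      by (intro ell2_eqI) simp
  qed (simp add: norm_ell2_def)
  show "norm (x + y) \<le> norm x + norm y"
    using ell2_minkowski(2)[OF coord_summable[of x] coord_summable[of y]]
    by (simp add: norm_ell2_def)
  have "(\<Sum>i. (cmod (coord (a *\<^sub>R x) i))\<^sup>2) = a\<^sup>2 * (\<Sum>i. (cmod (coord x i))\<^sup>2)"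
    by (simp add: norm_mult power_mult_distrib suminf_mult coord_summable)
  then show "norm (a *\<^sub>R x) = \<bar>a\<bar> * norm x"
    by (simp add: norm_ell2_def real_sqrt_mult)
qed (rule uniformity_ell2_def open_ell2_def)+

end

text \<open>The inner product is linear in its first argument.\<close>

definition cinner :: "ell2 \<Rightarrow> ell2 \<Rightarrow> complex" where
  "cinner x y = (\<Sum>i. coord x i * cnj (coord y i))"

text \<open>The standard basis vectors are \<open>basis 1, basis 2, \<dots>\<close>.\<close>

definition basis :: "nat \<Rightarrow> ell2" where
  "basis j = Abs_ell2 (\<lambda>i. if i = j \<and> 1 \<le> j then 1 else 0)"

text \<open>The orthogonal projection onto the span of the orthonormal family \<open>basis 1, \<dots>, basis m\<close>.\<close>

definition proj :: "nat \<Rightarrow> ell2 \<Rightarrow> ell2" where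
  "proj m x = (\<Sum>j=1..m. cscale (cinner x (basis j)) (basis j))"

definition bounded_op :: "(ell2 \<Rightarrow> ell2) \<Rightarrow> bool" where
  "bounded_op A \<longleftrightarrow> bounded_linear A \<and> (\<forall>c x. A (cscale c x) = cscale c (A x))"


section \<open>The problem\<close>

definition dispersion :: "(nat \<Rightarrow> nat) \<Rightarrow> nat \<Rightarrow> (ell2 \<Rightarrow> ell2) \<Rightarrow> real" where
  "dispersion f m A =
    max (onorm (\<lambda>x. A (proj m x) - proj (f m) (A (proj m x))))
        (onorm (\<lambda>x. proj m (A (x - proj (f m) x))))"

definition Omega :: "(nat \<Rightarrow> nat) \<Rightarrow> ((ell2 \<Rightarrow> ell2) \<times> ell2) set" where
  "Omega f =
    {A. bounded_op A \<and> bij A \<and> bounded_op (inv A) \<and> (\<lambda>m. dispersion f m A) \<longlonglongrightarrow> 0} \<times> UNIV"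

fun Xi :: "(ell2 \<Rightarrow> ell2) \<times> ell2 \<Rightarrow> ell2" where
  "Xi (A, b) = inv A b"

fun evalA :: "nat \<Rightarrow> nat \<Rightarrow> (ell2 \<Rightarrow> ell2) \<times> ell2 \<Rightarrow> complex" where
  "evalA i j (A, b) = cinner (A (basis j)) (basis i)"

fun evalb :: "nat \<Rightarrow> (ell2 \<Rightarrow> ell2) \<times> ell2 \<Rightarrow> complex" where
  "evalb i (A, b) = cinner b (basis i)"

definition real_rep :: "real representation" where
  "real_rep p x \<longleftrightarrow> (\<forall>j. \<bar>of_rat (nat_to_rat_surj (p j)) - x\<bar> \<le> 1 / 2 ^ j)"

definition complex_rep :: "complex representation" where
  "complex_rep p z \<longleftrightarrow> real_rep (evens p) (Re z) \<and> real_rep (odds p) (Im z)"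

definition seq_rep :: "'a representation \<Rightarrow> (nat \<Rightarrow> 'a) representation" where
  "seq_rep \<delta> p x \<longleftrightarrow> (\<forall>i. \<delta> (\<lambda>n. p (prod_encode (i, n))) (x i))"

text \<open>The evaluations are indexed by positive integers, hence the shifts by one.\<close>

definition input_rep :: "((ell2 \<Rightarrow> ell2) \<times> ell2) representation" where
  "input_rep p Ab \<longleftrightarrow>
    seq_rep (seq_rep complex_rep) (evens p) (\<lambda>i j. evalA (Suc i) (Suc j) Ab) \<and>
    seq_rep complex_rep (odds p) (\<lambda>i. evalb (Suc i) Ab)"

definition rat_complex :: "nat \<Rightarrow> complex" where
  "rat_complex n =
    (let (a, b) = prod_decode n
     in Complex (of_rat (nat_to_rat_surj a)) (of_rat (nat_to_rat_surj b)))"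

text \<open>The number \<open>n\<close> codes the list of coordinates \<open>1, \<dots>, length (list_decode n)\<close>.\<close>

definition rat_vec :: "nat \<Rightarrow> ell2" where
  "rat_vec n =
    (\<Sum>i<length (list_decode n). cscale (rat_complex (list_decode n ! i)) (basis (Suc i)))"

definition delta_H :: "ell2 representation" where
  "delta_H q x \<longleftrightarrow> (\<forall>k. norm (rat_vec (q k) - x) \<le> 1 / 2 ^ k)"

definition Solve :: "(nat \<Rightarrow> nat) \<Rightarrow> ((ell2 \<Rightarrow> ell2) \<times> ell2, ell2) problem" where
  "Solve f =
    \<lparr>in_rep = input_rep, out_rep = delta_H,
     sols = (\<lambda>Ab. if Ab \<in> Omega f then {Xi Ab} else {})\<rparr>"

definition SCI_lim_Comp :: "(nat \<Rightarrow> nat) \<Rightarrow> enat" where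
  "SCI_lim_Comp f =
    Inf {enat k |k. \<exists>K. computable K \<and>
      (\<forall>p. \<forall>Ab\<in>Omega f. input_rep p Ab \<longrightarrow>
        (\<exists>q r. K p = Some q \<and> Lim_pow k q = Some r \<and> delta_H r (Xi Ab)))}"

end

theory Submission
  imports Defs
begin

text \<open>
  The reduction of \<open>Solve f\<close> to \<open>Lim\<close> applies the inverse of \<open>A\<close> by guessing. Suppose \<open>\<parallel>x\<parallel> \<le> 2\<^sup>l \<parallel>A x\<parallel>\<close> for all \<open>x\<close>; then
  every rational vector \<open>v\<close> with \<open>\<parallel>b - A v\<parallel> \<le> 2 powr - (l + k)\<close> is within \<open>2 powr - k\<close> of \<open>A\<^sup>-\<^sup>1 b\<close>. The residual
  condition says that all finite partial sums of squares are small, so a violation is noticed after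
  finitely many steps. The lower bound on \<open>A\<close> compares \<open>\<parallel>x\<parallel>\<close> with the norm of the infinite vector
  \<open>A x\<close>, and a violation of it need not be noticed in this way. Here the dispersion helps: \<open>A x\<close> is,
  up to a small multiple of \<open>\<parallel>x\<parallel>\<close>, concentrated on its first \<open>f m\<close> coordinates when \<open>x\<close> is supported
  on the first \<open>m\<close> and \<open>m\<close> is large. Hence for some \<open>l\<close> already these finite truncations satisfy the
  lower bound, for all \<open>m > l\<close>, and conversely such truncated bounds imply the bound for \<open>A\<close>. Both
  conditions on a guess \<open>(l, v)\<close> are therefore refutable from the coordinates, correct guesses exist
  (\<open>bounded_below_test_complete\<close>, \<open>residual_test_complete\<close>), and the first guess that is never refuted
  is found with a single limit (\<open>first_unrefuted\<close>, \<open>solver_correct\<close>).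

  For the converse reduction let \<open>A = I\<close>. The task is then to pass from the coordinates of \<open>b\<close> to a norm name of \<open>b\<close>, that
  is, to find out where the tail of \<open>b\<close> becomes small. Given \<open>P\<close> in the domain of \<open>Lim\<close>, the vector
  \<open>change_vec P\<close> has one coordinate for each pair of a stage \<open>s\<close> and a column \<open>j\<close>; it is nonzero where
  column \<open>j\<close> changes at stage \<open>s\<close>, with a weight that depends only on \<open>j\<close> and on the number of earlier
  changes in that column. A norm name then tells by which stage the next change must have happened
  if it happens at all, and this determines the limits of the columns (\<open>limit_decoder\<close>).

  Solving without a limit is impossible because a computation reads only finitely much of its
  oracle (\<open>run_finite_use\<close>), while the names of \<open>(I, 0)\<close> and \<open>(I, e\<^sub>n)\<close> can agree on arbitrarily long
  prefixes (\<open>no_finite_use_solver\<close>).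
\<close>

section \<open>Programs computing total functions\<close>

text \<open>Computability is established for functions of one number; further arguments are packed with
  \<open>prod_encode\<close>. The rules below have conclusions \<open>crec (\<lambda>p x. t)\<close> in which \<open>t\<close> is built from smaller
  terms, so that the computability of an expression follows by applying them along its syntax. A
  bound variable \<open>i\<close> is turned into \<open>psnd y\<close> of a new argument \<open>y\<close>, and the old argument becomes
  \<open>pfst y\<close>.\<close>

definition crec :: "(baire \<Rightarrow> nat \<Rightarrow> nat) \<Rightarrow> bool" where
  "crec F \<longleftrightarrow> (\<exists>e. \<forall>p x. run e p [x] = Some (F p x))"

lemma crecI: "(\<And>p x. run e p [x] = Some (F p x)) \<Longrightarrow> crec F"
  unfolding crec_def by blast

lemma crecE:
  assumes "crec F"
  obtains e where "\<And>p x. run e p [x] = Some (F p x)"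
  using assms unfolding crec_def by blast

lemma crec_computable: "crec F \<Longrightarrow> computable (\<lambda>p. Some (F p))"
  by (erule crecE, unfold computable_def) (rule exI, auto simp: functional_def fun_eq_iff)

lemma crec_id: "crec (\<lambda>p x. x)"
  by (rule crecI[of "Proj 0"]) simp

lemma crec_comp1:
  assumes "crec g" "crec F"
  shows "crec (\<lambda>p x. g p (F p x))"
proof -
  obtain e1 where 1: "\<And>p x. run e1 p [x] = Some (g p x)" using crecE[OF assms(1)] by metis
  obtain e2 where 2: "\<And>p x. run e2 p [x] = Some (F p x)" using crecE[OF assms(2)] by metis
  show ?thesis
    by (rule crecI[of "Comp e1 [e2]"]) (simp add: 1 2)
qed

lemma crec_binary:
  assumes g: "\<And>p a b. run g p [a, b] = Some (h p a b)" and "crec F" "crec G"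
  shows "crec (\<lambda>p x. h p (F p x) (G p x))"
proof -
  obtain e1 where 1: "\<And>p x. run e1 p [x] = Some (F p x)" using crecE[OF assms(2)] by metis
  obtain e2 where 2: "\<And>p x. run e2 p [x] = Some (G p x)" using crecE[OF assms(3)] by metis
  show ?thesis
    by (rule crecI[of "Comp g [e1, e2]"]) (simp add: g 1 2)
qed

lemma crec_Suc: "crec F \<Longrightarrow> crec (\<lambda>p x. Suc (F p x))"
  by (rule crec_comp1[of "\<lambda>p. Suc"]) (auto intro: crecI[of Succ])

lemma crec_oracle: "crec F \<Longrightarrow> crec (\<lambda>p x. p (F p x))"
  by (rule crec_comp1[of "\<lambda>p. p"]) (auto intro: crecI[of Orac])

lemma crec_const: "crec (\<lambda>p x. c)"
proof (induction c)
  case 0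
  show ?case by (rule crecI[of Zero]) simp
next
  case (Suc c)
  then show ?case by (rule crec_Suc)
qed

definition add_prog :: recf where
  "add_prog = Prec (Proj 0) (Comp Succ [Proj 1])"

lemma run_add_prog: "run add_prog p [a, b] = Some (a + b)"
  by (induction a) (simp_all add: add_prog_def)

definition pred_prog :: recf where
  "pred_prog = Prec Zero (Proj 0)"

lemma run_pred_prog: "run pred_prog p [a] = Some (a - 1)"
  by (induction a) (simp_all add: pred_prog_def)

definition monus_prog :: recf where
  "monus_prog = Prec (Proj 0) (Comp pred_prog [Proj 1])"

lemma run_monus_prog: "run monus_prog p [b, a] = Some (a - b)"
  by (induction b) (simp_all add: monus_prog_def run_pred_prog)

definition mult_prog :: recf where
  "mult_prog = Prec Zero (Comp add_prog [Proj 2, Proj 1])"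

lemma run_mult_prog: "run mult_prog p [a, b] = Some (a * b)"
  by (induction a) (simp_all add: mult_prog_def run_add_prog numeral_2_eq_2)

lemma crec_add: "crec F \<Longrightarrow> crec G \<Longrightarrow> crec (\<lambda>p x. F p x + G p x)"
  by (rule crec_binary[of _ "\<lambda>p a b. a + b", OF run_add_prog])

lemma crec_mult: "crec F \<Longrightarrow> crec G \<Longrightarrow> crec (\<lambda>p x. F p x * G p x)"
  by (rule crec_binary[of _ "\<lambda>p a b. a * b", OF run_mult_prog])

lemma crec_diff: "crec F \<Longrightarrow> crec G \<Longrightarrow> crec (\<lambda>p x. F p x - G p x)"
  by (rule crec_binary[of _ "\<lambda>p b a. a - b", OF run_monus_prog])

subsection \<open>Pairing\<close>

definition triangle_prog :: recf where
  "triangle_prog = Prec Zero (Comp add_prog [Proj 1, Comp Succ [Proj 0]])"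

lemma run_triangle_prog: "run triangle_prog p [a] = Some (triangle a)"
  by (induction a) (simp_all add: triangle_prog_def run_add_prog)

definition pair_prog :: recf where
  "pair_prog = Comp add_prog [Comp triangle_prog [add_prog], Proj 0]"

lemma run_pair_prog: "run pair_prog p [a, b] = Some (prod_encode (a, b))"
  by (simp add: pair_prog_def run_add_prog run_triangle_prog prod_encode_def)

definition pfst :: "nat \<Rightarrow> nat" where "pfst n = fst (prod_decode n)"
definition psnd :: "nat \<Rightarrow> nat" where "psnd n = snd (prod_decode n)"

lemma pfst_prod_encode [simp]: "pfst (prod_encode (a, b)) = a"
  and psnd_prod_encode [simp]: "psnd (prod_encode (a, b)) = b"
  and prod_encode_pfst_psnd [simp]: "prod_encode (pfst n, psnd n) = n"
  by (simp_all add: pfst_def psnd_def)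

lemma pfst_le: "pfst n \<le> n" and psnd_le: "psnd n \<le> n"
  using le_prod_encode_1[of "pfst n" "psnd n"] le_prod_encode_2[of "psnd n" "pfst n"] by simp_all

text \<open>The number of the antidiagonal on which the \<open>n\<close>-th pair lies. As \<open>n\<close> grows by one it stays or
  grows by one, which makes it primitive recursive and gives access to the two components.\<close>

primrec diagonal :: "nat \<Rightarrow> nat" where
  "diagonal 0 = 0"
| "diagonal (Suc n) = diagonal n + (1 - (triangle (Suc (diagonal n)) - Suc n))"

lemma diagonal_bounds: "triangle (diagonal n) \<le> n \<and> n < triangle (Suc (diagonal n))"
proof (induction n)
  case (Suc n)
  then show ?case
    by (cases "triangle (Suc (diagonal n)) \<le> Suc n") auto
qed simp

lemma triangle_mono: "a \<le> b \<Longrightarrow> triangle a \<le> triangle b"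
  by (induction b) (auto simp: le_Suc_eq)

lemma diagonal_eq: "diagonal n = pfst n + psnd n"
proof -
  have n: "n = triangle (pfst n + psnd n) + pfst n"
    using prod_encode_pfst_psnd[of n] by (simp add: prod_encode_def)
  then have *: "triangle (pfst n + psnd n) \<le> n" "n < triangle (Suc (pfst n + psnd n))"
    by simp_all
  have "triangle a < triangle b \<Longrightarrow> a < b" for a b
    using triangle_mono[of b a] by linarith
  then have "diagonal n < Suc (pfst n + psnd n)" "pfst n + psnd n < Suc (diagonal n)"
    using * diagonal_bounds[of n] by (meson le_less_trans)+
  then  show ?thesis by simp
qed

lemma pfst_eq: "pfst n = n - triangle (diagonal n)"
  using prod_encode_pfst_psnd[of n] by (simp add: prod_encode_def diagonal_eq)

lemma psnd_eq: "psnd n = diagonal n - pfst n"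
  by (simp add: diagonal_eq)

lemma crec_diagonal: "crec (\<lambda>p. diagonal)"
proof (rule crecI)
  fix p x
  let ?h = "Comp add_prog [Proj 1, Comp monus_prog
      [Comp monus_prog [Comp Succ [Proj 0], Comp triangle_prog [Comp Succ [Proj 1]]],
       Comp Succ [Zero]]]"
  show "run (Prec Zero ?h) p [x] = Some (diagonal x)"
    by (induction x) (simp_all add: run_add_prog run_monus_prog run_triangle_prog del: triangle_Suc)
qed

lemma crec_triangle: "crec F \<Longrightarrow> crec (\<lambda>p x. triangle (F p x))"
  by (rule crec_comp1[of "\<lambda>p. triangle"]) (auto intro: crecI[of triangle_prog] run_triangle_prog)

lemma crec_pfst_fun: "crec (\<lambda>p. pfst)"
  unfolding pfst_eq[abs_def] by (intro crec_diff crec_triangle crec_diagonal crec_id)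

lemma crec_pfst: "crec F \<Longrightarrow> crec (\<lambda>p x. pfst (F p x))"
  by (rule crec_comp1[of "\<lambda>p. pfst", OF crec_pfst_fun])

lemma crec_psnd: "crec F \<Longrightarrow> crec (\<lambda>p x. psnd (F p x))"
proof (rule crec_comp1[of "\<lambda>p. psnd"])
  show "crec (\<lambda>p. psnd)"
    unfolding psnd_eq[abs_def] by (intro crec_diff crec_pfst_fun crec_diagonal)
qed

lemma crec_pair: "crec F \<Longrightarrow> crec G \<Longrightarrow> crec (\<lambda>p x. prod_encode (F p x, G p x))"
  by (rule crec_binary[of _ "\<lambda>p a b. prod_encode (a, b)", OF run_pair_prog])

subsection \<open>Recursion, sums and tests\<close>

text \<open>The parameter \<open>x\<close> stays available in the recursion because it is carried along as the second
  argument of \<open>Prec\<close>.\<close>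

lemma crec_rec:
  assumes "crec N" "crec B"
    and "crec (\<lambda>p y. S p (pfst y) (pfst (psnd y)) (psnd (psnd y)))"
  shows "crec (\<lambda>p x. rec_nat (B p x) (S p x) (N p x))"
proof -
  obtain b where b: "\<And>p x. run b p [x] = Some (B p x)" using crecE[OF assms(2)] by metis
  obtain s where s: "\<And>p y. run s p [y] = Some (S p (pfst y) (pfst (psnd y)) (psnd (psnd y)))"
    using crecE[OF assms(3)] by metis
  let ?h = "Comp s [Comp pair_prog [Proj 2, Comp pair_prog [Proj 0, Proj 1]]]"
  have *: "run (Prec b ?h) p [m, x] = Some (rec_nat (B p x) (S p x) m)" for p m x
    by (induction m) (simp_all add: b s run_pair_prog numeral_2_eq_2)
  show ?thesis
    by (rule crec_binary[of "Prec b ?h" "\<lambda>p m x. rec_nat (B p x) (S p x) m", OF *])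
      (intro assms crec_id)+
qed

lemma crec_sum:
  assumes "crec N" "crec (\<lambda>p y. F p (pfst y) (psnd y))"
  shows "crec (\<lambda>p x. \<Sum>i<N p x. F p x i)"
proof -
  have eq: "(\<Sum>i<n. g i) = rec_nat 0 (\<lambda>k r. r + g k) n" for g :: "nat \<Rightarrow> nat" and n
    by (induction n) auto
  have "crec (\<lambda>p y. F p (pfst y) (pfst (psnd y)))"
    using crec_comp1[OF assms(2), of "\<lambda>p y. prod_encode (pfst y, pfst (psnd y))"]
    by (simp add: crec_pair crec_pfst crec_psnd crec_id)
  then show ?thesis
    unfolding eq by (intro crec_rec assms crec_const crec_add crec_pfst crec_psnd crec_id)
qed

lemma crec_prod:
  assumes "crec N" "crec (\<lambda>p y. F p (pfst y) (psnd y))"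
  shows "crec (\<lambda>p x. \<Prod>i<N p x. F p x i)"
proof -
  have eq: "(\<Prod>i<n. g i) = rec_nat 1 (\<lambda>k r. r * g k) n" for g :: "nat \<Rightarrow> nat" and n
    by (induction n) auto
  have "crec (\<lambda>p y. F p (pfst y) (pfst (psnd y)))"
    using crec_comp1[OF assms(2), of "\<lambda>p y. prod_encode (pfst y, pfst (psnd y))"]
    by (simp add: crec_pair crec_pfst crec_psnd crec_id)
  then show ?thesis
    unfolding eq by (intro crec_rec assms crec_const crec_mult crec_pfst crec_psnd crec_id)
qed

lemma crec_outer_arg:
  assumes "crec F"
  shows "crec (\<lambda>p y. F p (pfst y))"
  by (rule crec_comp1[OF assms]) (intro crec_pfst crec_id)

lemma crec_power:
  assumes "crec F" "crec G" shows "crec (\<lambda>p x. F p x ^ G p x)"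
  using crec_prod[of G "\<lambda>p x i. F p x"] assms by (simp add: crec_outer_arg)

definition crec_pred :: "(baire \<Rightarrow> nat \<Rightarrow> bool) \<Rightarrow> bool" where
  "crec_pred Q \<longleftrightarrow> crec (\<lambda>p x. of_bool (Q p x))"

lemma crec_of_bool: "crec_pred Q \<Longrightarrow> crec (\<lambda>p x. of_bool (Q p x))"
  by (simp add: crec_pred_def)

lemma crec_pred_le: "crec F \<Longrightarrow> crec G \<Longrightarrow> crec_pred (\<lambda>p x. F p x \<le> G p x)"
proof -
  have *: "of_bool (a \<le> b) = 1 - (a - b)" for a b :: nat by auto
  show "crec F \<Longrightarrow> crec G \<Longrightarrow> crec_pred (\<lambda>p x. F p x \<le> G p x)"
    unfolding crec_pred_def * by (intro crec_diff crec_const)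
qed

lemma crec_pred_not: "crec_pred Q \<Longrightarrow> crec_pred (\<lambda>p x. \<not> Q p x)"
proof -
  have *: "of_bool (\<not> P) = (1 - of_bool P :: nat)" for P by auto
  show "crec_pred Q \<Longrightarrow> crec_pred (\<lambda>p x. \<not> Q p x)"
    unfolding crec_pred_def * by (intro crec_diff crec_const)
qed

lemma crec_pred_conj:
  "crec_pred Q \<Longrightarrow> crec_pred R \<Longrightarrow> crec_pred (\<lambda>p x. Q p x \<and> R p x)"
  unfolding crec_pred_def of_bool_conj by (rule crec_mult)

lemma crec_pred_less: "crec F \<Longrightarrow> crec G \<Longrightarrow> crec_pred (\<lambda>p x. F p x < G p x)"
  unfolding not_le[symmetric] by (intro crec_pred_not crec_pred_le)

lemma crec_pred_eq: "crec F \<Longrightarrow> crec G \<Longrightarrow> crec_pred (\<lambda>p x. F p x = G p x)"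
  unfolding eq_iff by (intro crec_pred_conj crec_pred_le)

lemma crec_pred_neq: "crec F \<Longrightarrow> crec G \<Longrightarrow> crec_pred (\<lambda>p x. F p x \<noteq> G p x)"
  by (intro crec_pred_not crec_pred_eq)

lemma crec_if:
  assumes "crec_pred Q" "crec F" "crec G"
  shows "crec (\<lambda>p x. if Q p x then F p x else G p x)"
proof -
  have *: "(if P then a else b) = of_bool P * a + (1 - of_bool P) * b" for P and a b :: nat by auto
  show ?thesis
    using assms unfolding crec_pred_def * by (intro crec_add crec_mult crec_diff crec_const)
qed

lemma crec_pred_ball:
  assumes "crec N" "crec_pred (\<lambda>p y. Q p (pfst y) (psnd y))"
  shows "crec_pred (\<lambda>p x. \<forall>i<N p x. Q p x i)"
proof -
  have *: "of_bool (\<forall>i<n. R i) = (\<Prod>i<n. of_bool (R i) :: nat)" for R and n :: nat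
    by (induction n) (auto simp: less_Suc_eq)
  show ?thesis
    using assms unfolding crec_pred_def * by (intro crec_prod)
qed

lemma crec_half: "crec F \<Longrightarrow> crec (\<lambda>p x. F p x div 2)"
proof (rule crec_comp1[of "\<lambda>p x. x div 2"])
  have *: "n div 2 = (\<Sum>i<n. of_bool (2 * Suc i \<le> n))" for n :: nat
  proof -
    have "(\<Sum>i<n. of_bool (2 * Suc i \<le> n)) = card {i. i < n \<and> 2 * Suc i \<le> n}"
      by (simp add: Int_def)
    also have "{i. i < n \<and> 2 * Suc i \<le> n} = {..<n div 2}" by auto
    finally show ?thesis by simp
  qed
  show "crec (\<lambda>p x. x div 2)"
    by (subst *) (intro crec_sum crec_of_bool crec_pred_le crec_mult crec_Suc crec_const
        crec_psnd crec_pfst crec_id)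
qed

lemma crec_pred_even: "crec F \<Longrightarrow> crec_pred (\<lambda>p x. even (F p x))"
proof -
  have *: "even n \<longleftrightarrow> 2 * (n div 2) = n" for n :: nat by presburger
  show "crec F \<Longrightarrow> crec_pred (\<lambda>p x. even (F p x))"
    unfolding * by (intro crec_pred_eq crec_mult crec_const crec_half)
qed

lemmas crec_basic = crec_id crec_const crec_Suc crec_add crec_mult crec_diff crec_pfst crec_psnd
  crec_pair crec_sum crec_power crec_if crec_of_bool crec_oracle crec_half
  crec_pred_le crec_pred_less crec_pred_eq crec_pred_neq crec_pred_not crec_pred_conj
  crec_pred_ball crec_pred_even

subsection \<open>Unbounded search\<close>

lemma run_search:
  assumes "crec G" "crec V"
  obtains e where "\<And>p x. \<exists>c. G p (prod_encode (c, x)) = 0 \<Longrightarrow>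
    run e p [x] = Some (V p (prod_encode (LEAST c. G p (prod_encode (c, x)) = 0, x)))"
proof -
  obtain g where g: "\<And>p x. run g p [x] = Some (G p x)" using crecE[OF assms(1)] by metis
  obtain v where v: "\<And>p x. run v p [x] = Some (V p x)" using crecE[OF assms(2)] by metis
  let ?mu = "Mu (Comp g [pair_prog])"
  have *: "run ?mu p [x] = Some (LEAST c. G p (prod_encode (c, x)) = 0)"
    if "\<exists>c. G p (prod_encode (c, x)) = 0" for p x
    using that by (simp add: g run_pair_prog)
  show ?thesis
  proof
    fix p x assume "\<exists>c. G p (prod_encode (c, x)) = 0"
    then show "run (Comp v [Comp pair_prog [?mu, Proj 0]]) p [x] =
        Some (V p (prod_encode (LEAST c. G p (prod_encode (c, x)) = 0, x)))"
      by (simp add: * v run_pair_prog del: run.simps(7))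
  qed
qed

subsection \<open>Coded lists\<close>

text \<open>The code of the list that remains after dropping \<open>i\<close> elements. The value \<open>0\<close>, the code of the
  empty list, is a fixed point since \<open>psnd 0 = 0\<close>.\<close>

definition ltail :: "nat \<Rightarrow> nat \<Rightarrow> nat" where
  "ltail n i = rec_nat n (\<lambda>_ r. psnd (r - 1)) i"

lemma ltail_simps [simp]: "ltail n 0 = n" "ltail n (Suc i) = psnd (ltail n i - 1)"
  by (simp_all add: ltail_def)

lemma psnd_0 [simp]: "psnd 0 = 0"
  using psnd_le[of 0] by simp

lemma list_decode_psnd: "list_decode (psnd (n - 1)) = tl (list_decode n)"
proof (cases n)
  case (Suc m)
  then show ?thesis by (auto simp: psnd_def split: prod.split)
qed simp

lemma list_decode_ltail: "list_decode (ltail n i) = drop i (list_decode n)"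
  by (induction i) (simp_all add: list_decode_psnd drop_Suc tl_drop del: One_nat_def)

definition llen :: "nat \<Rightarrow> nat" where "llen n = length (list_decode n)"
definition lnth :: "nat \<Rightarrow> nat \<Rightarrow> nat" where "lnth n i = pfst (ltail n i - 1)"

lemma lnth_eq: "i < llen n \<Longrightarrow> lnth n i = list_decode n ! i"
proof -
  assume "i < llen n"
  then have "list_decode (ltail n i) = list_decode n ! i # drop (Suc i) (list_decode n)"
    by (simp add: list_decode_ltail llen_def Cons_nth_drop_Suc)
  then show ?thesis
    unfolding lnth_def by (cases "ltail n i") (auto simp: pfst_def split: prod.splits)
qed

lemma llen_le: "llen n \<le> n"
proof (induction n rule: less_induct)
  case (less n)
  show ?case
  proof (cases n)
    case (Suc m)
    then have "llen n = Suc (llen (psnd m))"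
      by (simp add: llen_def psnd_def split: prod.split)
    also have "llen (psnd m) \<le> psnd m"
      using less[of "psnd m"] psnd_le[of m] Suc by simp
    finally show ?thesis using psnd_le[of m] Suc by simp
  qed (simp add: llen_def)
qed

lemma llen_sum: "llen n = (\<Sum>i<n. of_bool (ltail n i \<noteq> 0))"
proof -
  have "ltail n i \<noteq> 0 \<longleftrightarrow> i < llen n" for i
  proof -
    have "ltail n i = 0 \<longleftrightarrow> list_decode (ltail n i) = list_decode 0"
      by (simp only: list_decode_eq)
    also have "\<dots> \<longleftrightarrow> drop i (list_decode n) = []" by (simp add: list_decode_ltail)
    finally show ?thesis by (auto simp: llen_def)
  qed
  moreover have "{i. i < n \<and> i < llen n} = {..<llen n}" using llen_le[of n] by auto
  ultimately show ?thesis by (simp add: Int_def)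
qed

lemma crec_ltail: "crec F \<Longrightarrow> crec G \<Longrightarrow> crec (\<lambda>p x. ltail (F p x) (G p x))"
proof -
  have "crec (\<lambda>p x. ltail (pfst x) (psnd x))"
    unfolding ltail_def by (intro crec_rec crec_basic)
  then show "crec F \<Longrightarrow> crec G \<Longrightarrow> crec (\<lambda>p x. ltail (F p x) (G p x))"
    using crec_comp1[of "\<lambda>p x. ltail (pfst x) (psnd x)" "\<lambda>p x. prod_encode (F p x, G p x)"]
    by (simp add: crec_pair)
qed

lemma crec_lnth: "crec F \<Longrightarrow> crec G \<Longrightarrow> crec (\<lambda>p x. lnth (F p x) (G p x))"
  unfolding lnth_def by (intro crec_basic crec_ltail)

lemma crec_llen: "crec F \<Longrightarrow> crec (\<lambda>p x. llen (F p x))"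
proof (rule crec_comp1[of "\<lambda>p. llen"])
  show "crec (\<lambda>p. llen)"
    unfolding llen_sum[abs_def] by (intro crec_basic crec_ltail)
qed

section \<open>Rational arithmetic\<close>

text \<open>A sequence of rationals is computable when it is a quotient of computable numbers with a
  positive denominator. Signs are avoided by writing numerators as differences; any fraction will
  do, because the only use of these numbers is to compare them.\<close>

definition crec_rat :: "(baire \<Rightarrow> nat \<Rightarrow> real) \<Rightarrow> bool" where
  "crec_rat F \<longleftrightarrow> (\<exists>P N D. crec P \<and> crec N \<and> crec D \<and> (\<forall>p x. D p x > 0) \<and>
     F = (\<lambda>p x. (real (P p x) - real (N p x)) / real (D p x)))"

lemma crec_ratI:
  assumes "crec P" "crec N" "crec D" "\<And>p x. D p x > 0"
    "\<And>p x. F p x = (real (P p x) - real (N p x)) / real (D p x)"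
  shows "crec_rat F"
  unfolding crec_rat_def using assms by blast

lemma crec_ratE:
  assumes "crec_rat F"
  obtains P N D where "crec P" "crec N" "crec D" "\<And>p x. D p x > 0"
    "\<And>p x. F p x = (real (P p x) - real (N p x)) / real (D p x)"
  using assms unfolding crec_rat_def by metis

lemma crec_rat_real: "crec F \<Longrightarrow> crec_rat (\<lambda>p x. real (F p x))"
  by (rule crec_ratI[of F "\<lambda>p x. 0" "\<lambda>p x. 1"]) (auto intro: crec_const)

lemma crec_rat_const: "crec_rat (\<lambda>p x. real c)"
  by (intro crec_rat_real crec_const)

lemma crec_rat_0: "crec_rat (\<lambda>p x. 0)"
  using crec_rat_const[of 0] by simp

lemma crec_rat_1: "crec_rat (\<lambda>p x. 1)"
  using crec_rat_const[of 1] by simp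

lemma crec_rat_numeral: "crec_rat (\<lambda>p x. numeral c)"
  using crec_rat_const[of "numeral c"] by simp

lemma crec_rat_inverse_real:
  "crec F \<Longrightarrow> crec_rat (\<lambda>p x. 1 / real (F p x))"
  by (rule crec_ratI[of "\<lambda>p x. of_bool (0 < F p x)" "\<lambda>p x. 0"
        "\<lambda>p x. if 0 < F p x then F p x else 1"])
    (auto intro!: crec_basic)

lemma crec_rat_comp:
  assumes "crec_rat F" "crec G" shows "crec_rat (\<lambda>p x. F p (G p x))"
proof -
  obtain P N D where "crec P" "crec N" "crec D" "\<And>p x. D p x > 0"
    "\<And>p x. F p x = (real (P p x) - real (N p x)) / real (D p x)" using crec_ratE[OF assms(1)] by metis
  then show ?thesis
    by (intro crec_ratI[of "\<lambda>p x. P p (G p x)" "\<lambda>p x. N p (G p x)" "\<lambda>p x. D p (G p x)"]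
        crec_comp1[OF _ assms(2)])
qed

lemma crec_rat_add:
  assumes "crec_rat F" "crec_rat G" shows "crec_rat (\<lambda>p x. F p x + G p x)"
proof -
  obtain P N D where 1: "crec P" "crec N" "crec D" "\<And>p x. D p x > 0"
    "\<And>p x. F p x = (real (P p x) - real (N p x)) / real (D p x)" using crec_ratE[OF assms(1)] by metis
  obtain P' N' D' where 2: "crec P'" "crec N'" "crec D'" "\<And>p x. D' p x > 0"
    "\<And>p x. G p x = (real (P' p x) - real (N' p x)) / real (D' p x)" using crec_ratE[OF assms(2)] by metis
  have *: "D p x \<noteq> 0" "D' p x \<noteq> 0" for p x using 1(4)[of p x] 2(4)[of p x] by auto
  show ?thesis
    by (rule crec_ratI[of "\<lambda>p x. P p x * D' p x + P' p x * D p x"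
          "\<lambda>p x. N p x * D' p x + N' p x * D p x" "\<lambda>p x. D p x * D' p x"])
      (use * in \<open>auto intro!: crec_add crec_mult simp: 1 2 field_simps\<close>)
qed

lemma crec_rat_mult:
  assumes "crec_rat F" "crec_rat G" shows "crec_rat (\<lambda>p x. F p x * G p x)"
proof -
  obtain P N D where 1: "crec P" "crec N" "crec D" "\<And>p x. D p x > 0"
    "\<And>p x. F p x = (real (P p x) - real (N p x)) / real (D p x)" using crec_ratE[OF assms(1)] by metis
  obtain P' N' D' where 2: "crec P'" "crec N'" "crec D'" "\<And>p x. D' p x > 0"
    "\<And>p x. G p x = (real (P' p x) - real (N' p x)) / real (D' p x)" using crec_ratE[OF assms(2)] by metis
  show ?thesis
    by (rule crec_ratI[of "\<lambda>p x. P p x * P' p x + N p x * N' p x"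
          "\<lambda>p x. P p x * N' p x + N p x * P' p x" "\<lambda>p x. D p x * D' p x"])
      (auto intro!: crec_add crec_mult simp: 1 2 algebra_simps)
qed

lemma crec_rat_uminus: "crec_rat F \<Longrightarrow> crec_rat (\<lambda>p x. - F p x)"
  by (erule crec_ratE, rule crec_ratI) (auto simp: minus_divide_left)

lemma crec_rat_diff:
  assumes "crec_rat F" "crec_rat G" shows "crec_rat (\<lambda>p x. F p x - G p x)"
  using crec_rat_add[OF assms(1) crec_rat_uminus[OF assms(2)]] by simp

lemma crec_rat_square: "crec_rat F \<Longrightarrow> crec_rat (\<lambda>p x. (F p x)\<^sup>2)"
  unfolding power2_eq_square by (rule crec_rat_mult)

lemma crec_rat_if:
  assumes "crec_pred Q" "crec_rat F" "crec_rat G"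
  shows "crec_rat (\<lambda>p x. if Q p x then F p x else G p x)"
proof -
  have *: "(if P then a else b) = real (of_bool P) * a + (1 - real (of_bool P)) * b" for P a b by auto
  show ?thesis
    unfolding * by (intro crec_rat_add crec_rat_mult crec_rat_diff crec_rat_real crec_of_bool
        crec_rat_1 assms)
qed

lemma crec_rat_sum:
  assumes "crec M" "crec_rat (\<lambda>p y. F p (pfst y) (psnd y))"
  shows "crec_rat (\<lambda>p x. \<Sum>i<M p x. F p x i)"
proof -
  obtain P N D where 1: "crec P" "crec N" "crec D" "\<And>p x. D p x > 0"
    "\<And>p y. F p (pfst y) (psnd y) = (real (P p y) - real (N p y)) / real (D p y)"
    using crec_ratE[OF assms(2)] by metis
  let ?c = "\<lambda>x i. prod_encode (x, i)"
  have F: "F p x i = (real (P p (?c x i)) - real (N p (?c x i))) / real (D p (?c x i))" for p x i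
    using 1(5)[of p "?c x i"] by simp
  \<comment> \<open>Each term is expanded to the common denominator, the product of all denominators: \<open>cof\<close> is the
    product of the denominators of the other terms.\<close>
  define cof where "cof p x i = (\<Prod>j<M p x. if j = i then 1 else D p (?c x j))" for p x i
  have cof: "real (cof p x i) = (\<Prod>j<M p x. real (D p (?c x j))) / real (D p (?c x i))"
    if "i < M p x" for p x i
  proof -
    have "(\<Prod>j<M p x. real (D p (?c x j))) =
        real (D p (?c x i)) * (\<Prod>j\<in>{..<M p x} - {i}. real (D p (?c x j)))"
      using that by (simp add: prod.remove)
    moreover have "real (cof p x i) = (\<Prod>j\<in>{..<M p x} - {i}. real (D p (?c x j)))"
      unfolding cof_def of_nat_prod using that
      by (subst prod.remove[of _ i]) (auto intro: prod.cong)
    ultimately show ?thesis using 1(4)[of p "?c x i"] by simp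
  qed
  have crec2: "crec G \<Longrightarrow> crec A \<Longrightarrow> crec B \<Longrightarrow> crec (\<lambda>p y. G p (?c (A p y) (B p y)))" for G A B
    by (rule crec_comp1[of G]) (auto intro: crec_pair)
  have M: "crec A \<Longrightarrow> crec (\<lambda>p y. M p (A p y))" for A
    by (rule crec_comp1[OF assms(1)])
  have c: "crec (\<lambda>p y. cof p (pfst y) (psnd y))"
    unfolding cof_def by (intro crec_prod crec_basic M crec2 1)
  show ?thesis
  proof (rule crec_ratI)
    show "crec (\<lambda>p x. \<Sum>i<M p x. P p (?c x i) * cof p x i)"
      and "crec (\<lambda>p x. \<Sum>i<M p x. N p (?c x i) * cof p x i)"
      by (intro crec_sum crec_mult crec2 1 c assms crec_basic)+
    show "crec (\<lambda>p x. \<Prod>j<M p x. D p (?c x j))"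
      by (intro crec_prod crec2 1 assms crec_basic)
    show "0 < (\<Prod>j<M p x. D p (?c x j))" for p x
      by (intro prod_pos) (simp add: 1)
    fix p x
    have pos: "(\<Prod>j<M p x. real (D p (?c x j))) \<noteq> 0"
      using 1(4) by (auto simp: prod_zero_iff)
    have "(\<Sum>i<M p x. F p x i) * (\<Prod>j<M p x. real (D p (?c x j))) =
        (\<Sum>i<M p x. (real (P p (?c x i)) - real (N p (?c x i))) * real (cof p x i))"
      unfolding sum_distrib_right by (rule sum.cong) (auto simp: F cof)
    then show "(\<Sum>i<M p x. F p x i) = (real (\<Sum>i<M p x. P p (?c x i) * cof p x i) -
        real (\<Sum>i<M p x. N p (?c x i) * cof p x i)) / real (\<Prod>j<M p x. D p (?c x j))"
      using pos by (simp add: field_simps sum_subtractf)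
  qed
qed

lemma crec_pred_rat_le:
  assumes "crec_rat F" "crec_rat G" shows "crec_pred (\<lambda>p x. F p x \<le> G p x)"
proof -
  obtain P N D where 1: "crec P" "crec N" "crec D" "\<And>p x. D p x > 0"
    "\<And>p x. F p x = (real (P p x) - real (N p x)) / real (D p x)" using crec_ratE[OF assms(1)] by metis
  obtain P' N' D' where 2: "crec P'" "crec N'" "crec D'" "\<And>p x. D' p x > 0"
    "\<And>p x. G p x = (real (P' p x) - real (N' p x)) / real (D' p x)" using crec_ratE[OF assms(2)] by metis
  have "F p x \<le> G p x \<longleftrightarrow>
    P p x * D' p x + N' p x * D p x \<le> P' p x * D p x + N p x * D' p x" for p x
  proof -
    have "F p x \<le> G p x \<longleftrightarrow> real (P p x * D' p x + N' p x * D p x) \<le> real (P' p x * D p x + N p x * D' p x)"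
      using 1(4)[of p x] 2(4)[of p x] by (simp add: 1(5) 2(5) divide_simps algebra_simps)
    then show ?thesis by (simp only: of_nat_le_iff)
  qed
  then show ?thesis
    by (simp only:) (intro crec_pred_le crec_add crec_mult 1 2)
qed

lemma int_decode_eq_if:
  "int_decode n = (if even n then int (n div 2) else - int (Suc n div 2))"
  by (auto simp: int_decode_def sum_decode_def elim!: oddE)

definition rat_code :: "nat \<Rightarrow> real" where "rat_code n = of_rat (nat_to_rat_surj n)"

lemma rat_code_eq: "rat_code n = of_int (int_decode (pfst n)) / of_int (int_decode (psnd n))"
  by (auto simp: rat_code_def nat_to_rat_surj_def pfst_def psnd_def Fract_of_int_quotient
      of_rat_divide split: prod.split)

lemma crec_rat_code: "crec F \<Longrightarrow> crec_rat (\<lambda>p x. rat_code (F p x))"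
proof -
  \<comment> \<open>The coded denominator may be negative or zero; squaring it makes it nonnegative, and a zero
    denominator gives the value zero on both sides.\<close>
  have *: "rat_code n = of_int (int_decode (pfst n)) * of_int (int_decode (psnd n)) *
      (1 / real (nat ((int_decode (psnd n))\<^sup>2)))" for n
    by (simp add: rat_code_eq power2_eq_square)
  have i: "of_int (int_decode n) = (if even n then real (n div 2) else - real (Suc n div 2))" for n
    by (simp add: int_decode_eq_if)
  have s: "nat ((int_decode n)\<^sup>2) = (if even n then (n div 2)^2 else (Suc n div 2)^2)" for n
  proof -
    have "nat (z\<^sup>2) = (nat \<bar>z\<bar>)\<^sup>2" for z
      by (simp flip: nat_power_eq)
    then show ?thesis
      by (simp only: int_decode_eq_if) auto
  qed
  show "crec F \<Longrightarrow> crec_rat (\<lambda>p x. rat_code (F p x))"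
    unfolding * i s
    by (intro crec_rat_mult crec_rat_if crec_rat_real crec_rat_uminus crec_rat_inverse_real crec_basic)
qed

lemmas crec_rat_basic = crec_rat_0 crec_rat_1 crec_rat_numeral crec_rat_inverse_real crec_rat_add
  crec_rat_mult crec_rat_diff crec_rat_square crec_rat_sum crec_rat_code crec_pred_rat_le

definition crec_cx :: "(baire \<Rightarrow> nat \<Rightarrow> complex) \<Rightarrow> bool" where
  "crec_cx F \<longleftrightarrow> crec_rat (\<lambda>p x. Re (F p x)) \<and> crec_rat (\<lambda>p x. Im (F p x))"

lemma crec_cx_comp: "crec_cx F \<Longrightarrow> crec G \<Longrightarrow> crec_cx (\<lambda>p x. F p (G p x))"
  unfolding crec_cx_def using crec_rat_comp[of _ G] by blast

lemma crec_cx_diff: "crec_cx F \<Longrightarrow> crec_cx G \<Longrightarrow> crec_cx (\<lambda>p x. F p x - G p x)"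
  by (simp add: crec_cx_def crec_rat_diff)

lemma crec_cx_mult: "crec_cx F \<Longrightarrow> crec_cx G \<Longrightarrow> crec_cx (\<lambda>p x. F p x * G p x)"
  by (simp add: crec_cx_def crec_rat_diff crec_rat_add crec_rat_mult)

lemma crec_cx_sum:
  "crec M \<Longrightarrow> crec_cx (\<lambda>p y. F p (pfst y) (psnd y)) \<Longrightarrow> crec_cx (\<lambda>p x. \<Sum>i<M p x. F p x i)"
  by (simp add: crec_cx_def crec_rat_sum)

lemma crec_rat_cmod_square: "crec_cx F \<Longrightarrow> crec_rat (\<lambda>p x. (cmod (F p x))\<^sup>2)"
  unfolding cmod_power2 crec_cx_def by (intro crec_rat_basic) auto

lemma crec_cx_Complex:
  "crec_rat F \<Longrightarrow> crec_rat G \<Longrightarrow> crec_cx (\<lambda>p x. Complex (F p x) (G p x))"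
  by (simp add: crec_cx_def)

lemma crec_cx_rat_complex: "crec F \<Longrightarrow> crec_cx (\<lambda>p x. rat_complex (F p x))"
proof -
  have *: "rat_complex n = Complex (rat_code (pfst n)) (rat_code (psnd n))" for n
    by (simp add: rat_complex_def rat_code_def pfst_def psnd_def split: prod.split)
  show "crec F \<Longrightarrow> crec_cx (\<lambda>p x. rat_complex (F p x))"
    unfolding * by (intro crec_cx_Complex crec_rat_basic crec_basic)
qed

section \<open>Coordinates, truncations and rational vectors\<close>

lemma coord_Abs_ell2: "x 0 = 0 \<Longrightarrow> summable (\<lambda>i. (cmod (x i))\<^sup>2) \<Longrightarrow> coord (Abs_ell2 x) = x"
  by (simp add: Abs_ell2_inverse)

lemma norm_ell2_sums: "(\<lambda>i. (cmod (coord x (Suc i)))\<^sup>2) sums (norm x)\<^sup>2"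
proof -
  have "(\<lambda>i. (cmod (coord x i))\<^sup>2) sums (norm x)\<^sup>2"
    using coord_summable[of x] by (simp add: norm_ell2_def suminf_nonneg summable_sums)
  then show ?thesis
    by (subst sums_Suc_iff) simp
qed

lemma norm_ell2_ge_partial: "(\<Sum>i<N. (cmod (coord x (Suc i)))\<^sup>2) \<le> (norm x)\<^sup>2"
proof -
  have "(\<Sum>i<N. (cmod (coord x (Suc i)))\<^sup>2) \<le> (\<Sum>i. (cmod (coord x (Suc i)))\<^sup>2)"
    by (rule sum_le_suminf) (use norm_ell2_sums[of x] in \<open>auto simp: sums_iff\<close>)
  then show ?thesis using norm_ell2_sums[of x] by (simp add: sums_iff)
qed

text \<open>Norm bounds are statements about finite partial sums, which is what makes the residual
  condition refutable.\<close>

lemma norm_ell2_le_partial: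
  assumes "\<And>N. (\<Sum>i<N. (cmod (coord x (Suc i)))\<^sup>2) \<le> B"
  shows "(norm x)\<^sup>2 \<le> B"
  using norm_ell2_sums[of x] assms by (auto simp: sums_def intro: LIMSEQ_le_const2)

lemma norm_ell2_finite:
  assumes "\<And>i. i \<ge> N \<Longrightarrow> coord x (Suc i) = 0"
  shows "(norm x)\<^sup>2 = (\<Sum>i<N. (cmod (coord x (Suc i)))\<^sup>2)"
  using norm_ell2_sums[of x] sums_finite[of "{..<N}" "\<lambda>i. (cmod (coord x (Suc i)))\<^sup>2"] assms
  by (auto intro: sums_unique2)

lemma cmod_coord_le_norm: "cmod (coord x i) \<le> norm x"
proof (cases i)
  case (Suc k)
  have "(cmod (coord x (Suc k)))\<^sup>2 \<le> (\<Sum>i<Suc k. (cmod (coord x (Suc i)))\<^sup>2)"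
    by (simp add: sum_nonneg)
  also have "\<dots> \<le> (norm x)\<^sup>2" by (rule norm_ell2_ge_partial)
  finally show ?thesis using Suc by (auto intro: power2_le_imp_le)
qed simp

lemma coord_basis: "coord (basis j) i = (if i = j \<and> 1 \<le> j then 1 else 0)"
proof -
  have "summable (\<lambda>i. (cmod (if i = j \<and> 1 \<le> j then 1 else 0))\<^sup>2)"
    by (rule summable_finite[of "{j}"]) auto
  then show ?thesis
    unfolding basis_def by (subst coord_Abs_ell2) auto
qed

lemma cinner_basis: "cinner x (basis j) = coord x j"
proof -
  have "(\<lambda>i. coord x i * cnj (coord (basis j) i)) sums
      (\<Sum>i\<in>{j}. coord x i * cnj (coord (basis j) i))"
    by (rule sums_finite) (auto simp: coord_basis)
  then have "cinner x (basis j) = coord x j * cnj (coord (basis j) j)"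
    unfolding cinner_def by (simp add: sums_iff)
  also have "\<dots> = coord x j"
    by (cases j) (simp_all add: coord_basis)
  finally show ?thesis .
qed

lemma coord_sum: "coord (\<Sum>i\<in>S. F i) k = (\<Sum>i\<in>S. coord (F i) k)"
  by (induction S rule: infinite_finite_induct) auto

lemma coord_proj: "coord (proj m x) i = (if i \<le> m then coord x i else 0)"
proof -
  have "coord (proj m x) i = (\<Sum>j=1..m. if j = i then coord x i else 0)"
    unfolding proj_def coord_sum cinner_basis
    by (rule sum.cong) (auto simp: coord_basis)
  also have "\<dots> = (if i \<le> m then coord x i else 0)"
    by (cases i) auto
  finally show ?thesis .
qed

lemma norm_proj_le: "norm (proj m x) \<le> norm x"
proof -
  have "(norm (proj m x))\<^sup>2 \<le> (norm x)\<^sup>2"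
  proof (rule norm_ell2_le_partial)
    fix N
    have "(\<Sum>i<N. (cmod (coord (proj m x) (Suc i)))\<^sup>2) \<le> (\<Sum>i<N. (cmod (coord x (Suc i)))\<^sup>2)"
      by (rule sum_mono) (simp add: coord_proj)
    then show "(\<Sum>i<N. (cmod (coord (proj m x) (Suc i)))\<^sup>2) \<le> (norm x)\<^sup>2"
      using norm_ell2_ge_partial[where x=x and N=N] by linarith
  qed
  then show ?thesis by (rule power2_le_imp_le) simp
qed

lemma bounded_linear_proj: "bounded_linear (proj m)"
  by (rule bounded_linear_intro[where K = 1])
    (auto intro!: ell2_eqI norm_proj_le simp: coord_proj algebra_simps)

lemma norm_proj_square: "(norm (proj m x))\<^sup>2 = (\<Sum>i<m. (cmod (coord x (Suc i)))\<^sup>2)"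
proof -
  have "(norm (proj m x))\<^sup>2 = (\<Sum>i<m. (cmod (coord (proj m x) (Suc i)))\<^sup>2)"
    by (rule norm_ell2_finite) (simp add: coord_proj)
  also have "\<dots> = (\<Sum>i<m. (cmod (coord x (Suc i)))\<^sup>2)"
    by (rule sum.cong) (auto simp: coord_proj)
  finally show ?thesis .
qed

abbreviation entry :: "nat \<Rightarrow> nat \<Rightarrow> complex" where
  "entry n j \<equiv> rat_complex (lnth n j)"

lemma rat_vec_eq: "rat_vec n = (\<Sum>j<llen n. cscale (entry n j) (basis (Suc j)))"
  unfolding rat_vec_def llen_def[symmetric] by (rule sum.cong) (auto simp: lnth_eq)

lemma coord_rat_vec: "coord (rat_vec n) (Suc i) = (if i < llen n then entry n i else 0)"
proof -
  have "coord (rat_vec n) (Suc i) = (\<Sum>j<llen n. if j = i then entry n i else 0)"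
    unfolding rat_vec_eq coord_sum by (rule sum.cong) (auto simp: coord_basis)
  then show ?thesis by simp
qed

lemma norm_rat_vec_square: "(norm (rat_vec n))\<^sup>2 = (\<Sum>j<llen n. (cmod (entry n j))\<^sup>2)"
proof -
  have "(norm (rat_vec n))\<^sup>2 = (\<Sum>j<llen n. (cmod (coord (rat_vec n) (Suc j)))\<^sup>2)"
    by (rule norm_ell2_finite) (simp add: coord_rat_vec)
  then show ?thesis by (simp add: coord_rat_vec)
qed

lemma proj_rat_vec: "llen n \<le> m \<Longrightarrow> proj m (rat_vec n) = rat_vec n"
proof (rule ell2_eqI)
  fix i assume "llen n \<le> m"
  then show "coord (proj m (rat_vec n)) i = coord (rat_vec n) i"
    by (cases i) (auto simp: coord_proj coord_rat_vec)
qed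

lemma coord_apply_rat_vec:
  assumes "bounded_op A"
  shows "coord (A (rat_vec n)) k = (\<Sum>j<llen n. coord (A (basis (Suc j))) k * entry n j)"
proof -
  interpret bounded_linear A using assms by (simp add: bounded_op_def)
  show ?thesis
    using assms unfolding rat_vec_eq sum coord_sum bounded_op_def
    by (simp add: mult.commute)
qed

lemma rat_complex_dense:
  assumes "0 < e" shows "\<exists>c. cmod (rat_complex c - z) < e"
proof -
  have rat: "\<exists>a. \<bar>of_rat (nat_to_rat_surj a) - x\<bar> < e / 2" for x :: real
  proof -
    obtain q where q: "q \<in> \<rat>" "x < q" "q < x + e / 2"
      using Rats_dense_in_real[of x "x + e / 2"] assms by auto
    then obtain a where "q = of_rat (nat_to_rat_surj a)"
      using surj_of_rat_nat_to_rat_surj by metis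
    with q show ?thesis by (intro exI[of _ a]) auto
  qed
  obtain a b where "\<bar>of_rat (nat_to_rat_surj a) - Re z\<bar> < e / 2"
    "\<bar>of_rat (nat_to_rat_surj b) - Im z\<bar> < e / 2"
    using rat by blast
  then have "cmod (rat_complex (prod_encode (a, b)) - z) < e"
    using cmod_le[of "rat_complex (prod_encode (a, b)) - z"] by (simp add: rat_complex_def)
  then show ?thesis ..
qed

text \<open>Truncating \<open>x\<close> after \<open>N\<close> coordinates costs at most a quarter of \<open>e\<^sup>2\<close>, and approximating the
  first \<open>N\<close> coordinates by rationals costs at most another quarter.\<close>

lemma rat_vec_dense:
  assumes "0 < e" shows "\<exists>n. norm (rat_vec n - x) < e"
proof -
  let ?c = "\<lambda>i. (cmod (coord x (Suc i)))\<^sup>2"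
  have "(\<lambda>N. \<Sum>i<N. ?c i) \<longlonglongrightarrow> (norm x)\<^sup>2"
    using norm_ell2_sums[of x] by (simp add: sums_def)
  moreover have "(norm x)\<^sup>2 - e\<^sup>2 / 4 < (norm x)\<^sup>2" using assms by simp
  ultimately have "\<forall>\<^sub>F N in sequentially. (norm x)\<^sup>2 - e\<^sup>2 / 4 < (\<Sum>i<N. ?c i)"
    by (rule order_tendstoD)
  then obtain N where N: "(norm x)\<^sup>2 - e\<^sup>2 / 4 < (\<Sum>i<N. ?c i)"
    by (auto simp: eventually_sequentially)
  define d where "d = e / (2 * (real N + 1))"
  have "0 < d" using assms by (simp add: d_def)
  then have "\<forall>i. \<exists>c. cmod (rat_complex c - coord x (Suc i)) < d"
    using rat_complex_dense by blast
  then obtain c where c: "\<forall>i. cmod (rat_complex (c i) - coord x (Suc i)) < d"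
    by (rule choice[THEN exE])
  define n where "n = list_encode (map c [0..<N])"
  have n: "llen n = N" by (simp add: llen_def n_def)
  then have entry: "entry n i = rat_complex (c i)" if "i < N" for i
    using that lnth_eq[of i n] by (simp add: n_def)
  have sq: "(cmod (entry n i - coord x (Suc i)))\<^sup>2 \<le> d\<^sup>2" if "i < N" for i
    using c that by (intro power_mono) (auto simp: entry intro: less_imp_le)
  have "real N * d\<^sup>2 \<le> e\<^sup>2 / 4"
  proof -
    have "real N * d\<^sup>2 \<le> (real N + 1)\<^sup>2 * d\<^sup>2"
      by (intro mult_right_mono) (auto simp: power2_eq_square algebra_simps)
    also have "\<dots> = ((real N + 1) * d)\<^sup>2" by (simp add: power_mult_distrib)
    also have "(real N + 1) * d = e / 2" by (simp add: d_def field_simps)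
    finally show ?thesis by (simp add: power_divide)
  qed
  have "(norm (rat_vec n - x))\<^sup>2 \<le> e\<^sup>2 / 2"
  proof (rule norm_ell2_le_partial)
    fix M
    let ?g = "\<lambda>i. (cmod (coord (rat_vec n - x) (Suc i)))\<^sup>2"
    have split: "(\<Sum>i<N + M. h i) = (\<Sum>i<N. h i) + (\<Sum>i\<in>{N..<N+M}. h i)" for h :: "nat \<Rightarrow> real"
      unfolding lessThan_atLeast0 by (rule sum.atLeastLessThan_concat[symmetric]) simp_all
    have "(\<Sum>i<M. ?g i) \<le> (\<Sum>i<N + M. ?g i)"
      by (rule sum_mono2) auto
    also have "\<dots> = (\<Sum>i<N. ?g i) + (\<Sum>i\<in>{N..<N+M}. ?g i)"
      by (rule split)
    also have "(\<Sum>i<N. ?g i) \<le> (\<Sum>i<N. d\<^sup>2)"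
      by (rule sum_mono) (use sq in \<open>auto simp: coord_rat_vec n\<close>)
    also have "(\<Sum>i<N. d\<^sup>2) \<le> e\<^sup>2 / 4"
      using \<open>real N * d\<^sup>2 \<le> e\<^sup>2 / 4\<close> by simp
    also have "(\<Sum>i\<in>{N..<N+M}. ?g i) = (\<Sum>i\<in>{N..<N+M}. ?c i)"
      by (rule sum.cong) (auto simp: coord_rat_vec n)
    also have "(\<Sum>i\<in>{N..<N+M}. ?c i) = (\<Sum>i<N+M. ?c i) - (\<Sum>i<N. ?c i)"
      using split[of ?c] by simp
    also have "\<dots> \<le> e\<^sup>2 / 4"
      using N norm_ell2_ge_partial[of x "N + M"] by linarith
    finally show "(\<Sum>i<M. ?g i) \<le> e\<^sup>2 / 2" by simp
  qed
  also have "\<dots> < e\<^sup>2" using assms by simp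
  finally have "norm (rat_vec n - x) < e"
    by (rule power2_less_imp_less) (use assms in simp)
  then show ?thesis ..
qed

section \<open>Solving with one limit\<close>

text \<open>In a name \<open>p\<close> the even positions belong to \<open>A\<close> and the odd ones to \<open>b\<close>; within the name of a complex
  number they belong to the real and the imaginary part. Counting starts at \<open>0\<close> in names and at \<open>1\<close> for
  coordinates, so row \<open>i\<close> is about the coordinate \<open>Suc i\<close>.\<close>

definition approx_A :: "baire \<Rightarrow> nat \<Rightarrow> nat \<Rightarrow> nat \<Rightarrow> complex" where
  "approx_A p s i j =
    Complex (rat_code (p (2 * prod_encode (i, prod_encode (j, 2 * s)))))
      (rat_code (p (2 * prod_encode (i, prod_encode (j, 2 * s + 1)))))"

definition approx_b :: "baire \<Rightarrow> nat \<Rightarrow> nat \<Rightarrow> complex" where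
  "approx_b p s i =
    Complex (rat_code (p (2 * prod_encode (i, 2 * s) + 1)))
      (rat_code (p (2 * prod_encode (i, 2 * s + 1) + 1)))"

lemma complex_rep_error:
  assumes "complex_rep q z"
  shows "cmod (Complex (rat_code (q (2 * s))) (rat_code (q (2 * s + 1))) - z) \<le> 2 / 2 ^ s"
proof -
  have "\<bar>rat_code (q (2 * s)) - Re z\<bar> \<le> 1 / 2 ^ s" "\<bar>rat_code (q (2 * s + 1)) - Im z\<bar> \<le> 1 / 2 ^ s"
    using assms by (simp_all add: complex_rep_def real_rep_def evens_def odds_def rat_code_def)
  then show ?thesis
    using cmod_le[of "Complex (rat_code (q (2 * s))) (rat_code (q (2 * s + 1))) - z"] by simp
qed

lemma approx_A_error:
  assumes "input_rep p (A, b)"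
  shows "cmod (approx_A p s i j - coord (A (basis (Suc j))) (Suc i)) \<le> 2 / 2 ^ s"
proof -
  have "complex_rep (\<lambda>n. evens p (prod_encode (i, prod_encode (j, n)))) (coord (A (basis (Suc j))) (Suc i))"
    using assms by (simp add: input_rep_def seq_rep_def cinner_basis)
  from complex_rep_error[OF this, of s] show ?thesis
    by (simp add: approx_A_def evens_def)
qed

lemma approx_b_error:
  assumes "input_rep p (A, b)"
  shows "cmod (approx_b p s i - coord b (Suc i)) \<le> 2 / 2 ^ s"
proof -
  have "complex_rep (\<lambda>n. odds p (prod_encode (i, n))) (coord b (Suc i))"
    using assms by (simp add: input_rep_def seq_rep_def cinner_basis)
  from complex_rep_error[OF this, of s] show ?thesis
    by (simp add: approx_b_def odds_def)
qed

definition approx_image :: "baire \<Rightarrow> nat \<Rightarrow> nat \<Rightarrow> nat \<Rightarrow> complex" where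
  "approx_image p s n i = (\<Sum>j<llen n. approx_A p s i j * entry n j)"

text \<open>A rational bound for the error that precision \<open>s\<close> causes in a coordinate of \<open>A v\<close> or \<open>b - A v\<close>. The
  absolute values of the entries of \<open>v\<close>, which can be irrational, are replaced by \<open>1 + \<bar>z\<bar>\<^sup>2\<close>.\<close>

definition slack :: "nat \<Rightarrow> nat \<Rightarrow> real" where
  "slack s n = 2 * (1 / real (2 ^ s)) * (1 + (\<Sum>j<llen n. 1 + (cmod (entry n j))\<^sup>2))"

lemma le_one_plus_square: "x \<le> 1 + (x::real)\<^sup>2"
proof -
  have "0 \<le> (x - 1)\<^sup>2 + x\<^sup>2 + 1" by simp
  then show ?thesis by (simp add: power2_eq_square algebra_simps)
qed

lemma approx_image_error_aux:
  assumes "bounded_op A" "input_rep p (A, b)"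
  shows "cmod (approx_image p s n i - coord (A (rat_vec n)) (Suc i)) \<le>
    2 / 2 ^ s * (\<Sum>j<llen n. 1 + (cmod (entry n j))\<^sup>2)"
proof -
  have "approx_image p s n i - coord (A (rat_vec n)) (Suc i) =
      (\<Sum>j<llen n. (approx_A p s i j - coord (A (basis (Suc j))) (Suc i)) * entry n j)"
    unfolding coord_apply_rat_vec[OF assms(1)] approx_image_def
    by (simp add: sum_subtractf left_diff_distrib)
  also have "cmod \<dots> \<le>
      (\<Sum>j<llen n. cmod ((approx_A p s i j - coord (A (basis (Suc j))) (Suc i)) * entry n j))"
    by (rule norm_sum)
  also have "\<dots> \<le> (\<Sum>j<llen n. 2 / 2 ^ s * (1 + (cmod (entry n j))\<^sup>2))"
    unfolding norm_mult
    by (intro sum_mono mult_mono approx_A_error[OF assms(2)] le_one_plus_square) auto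
  finally show ?thesis by (simp add: sum_distrib_left)
qed

lemma approx_image_error:
  assumes "bounded_op A" "input_rep p (A, b)"
  shows "cmod (approx_image p s n i - coord (A (rat_vec n)) (Suc i)) \<le> slack s n"
proof -
  have "cmod (approx_image p s n i - coord (A (rat_vec n)) (Suc i)) \<le>
      2 / 2 ^ s * (\<Sum>j<llen n. 1 + (cmod (entry n j))\<^sup>2)"
    by (rule approx_image_error_aux[OF assms])
  also have "\<dots> \<le> slack s n" by (simp add: slack_def distrib_left)
  finally show ?thesis .
qed

lemma residual_error:
  assumes "bounded_op A" "input_rep p (A, b)"
  shows "cmod ((approx_b p s i - approx_image p s n i) - coord (b - A (rat_vec n)) (Suc i)) \<le> slack s n"
proof -
  have "cmod ((approx_b p s i - approx_image p s n i) - coord (b - A (rat_vec n)) (Suc i)) =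
      cmod ((approx_b p s i - coord b (Suc i)) - (approx_image p s n i - coord (A (rat_vec n)) (Suc i)))"
    by (simp add: algebra_simps)
  also have "\<dots> \<le> cmod (approx_b p s i - coord b (Suc i)) +
      cmod (approx_image p s n i - coord (A (rat_vec n)) (Suc i))"
    by (rule norm_triangle_ineq4)
  also have "\<dots> \<le> 2 / 2 ^ s + 2 / 2 ^ s * (\<Sum>j<llen n. 1 + (cmod (entry n j))\<^sup>2)"
    by (intro add_mono approx_b_error[OF assms(2)] approx_image_error_aux[OF assms])
  also have "\<dots> = slack s n" by (simp add: slack_def distrib_left)
  finally show ?thesis .
qed

lemma slack_tendsto: "(\<lambda>s. slack s n) \<longlonglongrightarrow> 0"
proof -
  have "(\<lambda>s. 2 / 2 ^ s * (1 + (\<Sum>j<llen n. 1 + (cmod (entry n j))\<^sup>2))) \<longlonglongrightarrow>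
      0 * (1 + (\<Sum>j<llen n. 1 + (cmod (entry n j))\<^sup>2))"
    by (intro tendsto_mult tendsto_const LIMSEQ_divide_realpow_zero) simp
  then show ?thesis by (simp add: slack_def)
qed

lemma tendsto_by_slack:
  fixes g :: "nat \<Rightarrow> complex"
  assumes "\<And>s. cmod (g s - a) \<le> slack s n" shows "g \<longlonglongrightarrow> a"
  by (rule LIM_zero_cancel, rule Lim_null_comparison[OF _ slack_tendsto[of n]]) (simp add: assms)

text \<open>The factor \<open>2\<close> allows true and approximate values to be exchanged without square roots, at the
  price of constants that the tests below absorb.\<close>

lemma cmod_square_perturb:
  assumes "cmod (a - b) \<le> e" shows "(cmod a)\<^sup>2 \<le> 2 * (cmod b)\<^sup>2 + 2 * e\<^sup>2"
proof -
  have "cmod a \<le> cmod b + e"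
    using assms norm_triangle_sub[of a b] by linarith
  then have "(cmod a)\<^sup>2 \<le> (cmod b + e)\<^sup>2" by (intro power_mono) auto
  also have "\<dots> \<le> 2 * (cmod b)\<^sup>2 + 2 * e\<^sup>2"
    using sum_squares_bound[of "cmod b" e] by (simp add: power2_sum)
  finally show ?thesis .
qed

text \<open>The inequality \<open>\<parallel>x\<parallel> \<le> 2\<^sup>l \<parallel>A x\<parallel>\<close> for \<open>x = rat_vec n\<close>, squared, with \<open>A x\<close> cut off and approximated
  and with an allowance for the approximation error that vanishes as \<open>s\<close> grows. The cut-off belongs
  to the dimension \<open>Suc (llen n + l)\<close>: it contains the support of \<open>x\<close>, and it exceeds \<open>l\<close>, so that a
  large \<open>l\<close> excludes the dimensions in which the dispersion is still large.\<close>

definition bounded_below_test :: "(nat \<Rightarrow> nat) \<Rightarrow> baire \<Rightarrow> nat \<Rightarrow> nat \<Rightarrow> nat \<Rightarrow> bool" where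
  "bounded_below_test f p l n s \<longleftrightarrow>
    (\<Sum>j<llen n. (cmod (entry n j))\<^sup>2) \<le>
    real (4 ^ l) * (\<Sum>i<f (Suc (llen n + l)). (cmod (approx_image p s n i))\<^sup>2 + (slack s n)\<^sup>2)"

text \<open>The first \<open>N\<close> coordinates of the inequality \<open>\<parallel>b - A v\<parallel> \<le> 2 powr - (l + k)\<close> for \<open>v = rat_vec n\<close>,
  squared, with an allowance for the approximation error.\<close>

definition residual_test :: "baire \<Rightarrow> nat \<Rightarrow> nat \<Rightarrow> nat \<Rightarrow> nat \<Rightarrow> nat \<Rightarrow> bool" where
  "residual_test p k l n N s \<longleftrightarrow>
    (\<Sum>i<N. (cmod (approx_b p s i - approx_image p s n i))\<^sup>2) \<le>
    1 / real (4 ^ (l + k)) + (\<Sum>i<N. 2 * (slack s n)\<^sup>2)"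

text \<open>Let the precision tend to infinity for each rational vector, then use that these are dense.\<close>

lemma bounded_below_testD:
  assumes A: "bounded_op A" "input_rep p (A, b)"
    and test: "\<And>n s. bounded_below_test f p l n s"
  shows "norm x \<le> 2 ^ l * norm (A x)"
proof -
  have vec: "norm (rat_vec n) \<le> 2 ^ l * norm (A (rat_vec n))" for n
  proof -
    let ?F = "f (Suc (llen n + l))"
    let ?c = "\<lambda>i. coord (A (rat_vec n)) (Suc i)"
    have "(\<lambda>s. 4 ^ l * (\<Sum>i<?F. (cmod (approx_image p s n i))\<^sup>2 + (slack s n)\<^sup>2)) \<longlonglongrightarrow>
        4 ^ l * (\<Sum>i<?F. (cmod (?c i))\<^sup>2 + 0\<^sup>2)"
      by (intro tendsto_intros tendsto_by_slack[OF approx_image_error[OF A]] slack_tendsto)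
    then have "(norm (rat_vec n))\<^sup>2 \<le> 4 ^ l * (\<Sum>i<?F. (cmod (?c i))\<^sup>2 + 0\<^sup>2)"
      by (rule LIMSEQ_le_const)
        (use test in \<open>auto simp: bounded_below_test_def norm_rat_vec_square\<close>)
    also have "\<dots> \<le> 4 ^ l * (norm (A (rat_vec n)))\<^sup>2"
      using norm_ell2_ge_partial[where x = "A (rat_vec n)" and N = ?F] by simp
    also have "\<dots> = (2 ^ l * norm (A (rat_vec n)))\<^sup>2"
      by (simp add: power_mult_distrib flip: power_mult) (simp add: power_mult power2_eq_square mult.commute[of l])
    finally show ?thesis by (rule power2_le_imp_le) simp
  qed
  interpret bounded_linear A using A by (simp add: bounded_op_def)
  have "closed {x. norm x \<le> 2 ^ l * norm (A x)}"
    by (intro closed_Collect_le continuous_intros linear_continuous_on bounded_linear_axioms)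
  moreover have "x \<in> closure {x. norm x \<le> 2 ^ l * norm (A x)}"
    unfolding closure_approachable dist_norm
    using rat_vec_dense[where x = x] vec by blast
  ultimately show ?thesis by simp
qed

lemma residual_testD:
  assumes A: "bounded_op A" "input_rep p (A, b)"
    and test: "\<And>N s. residual_test p k l n N s"
  shows "norm (b - A (rat_vec n)) \<le> 1 / 2 ^ (l + k)"
proof -
  have "(norm (b - A (rat_vec n)))\<^sup>2 \<le> 1 / 4 ^ (l + k)"
  proof (rule norm_ell2_le_partial)
    fix N
    let ?c = "\<lambda>i. coord (b - A (rat_vec n)) (Suc i)"
    have 1: "(\<lambda>s. \<Sum>i<N. (cmod (approx_b p s i - approx_image p s n i))\<^sup>2) \<longlonglongrightarrow> (\<Sum>i<N. (cmod (?c i))\<^sup>2)"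
      by (intro tendsto_sum tendsto_power tendsto_norm tendsto_by_slack[OF residual_error[OF A]])
    have 2: "(\<lambda>s. 1 / real (4 ^ (l + k)) + (\<Sum>i<N. 2 * (slack s n)\<^sup>2)) \<longlonglongrightarrow>
        1 / real (4 ^ (l + k)) + (\<Sum>i<N. 2 * 0\<^sup>2)"
      by (intro tendsto_intros slack_tendsto)
    have "(\<Sum>i<N. (cmod (?c i))\<^sup>2) \<le> 1 / real (4 ^ (l + k)) + (\<Sum>i<N. 2 * 0\<^sup>2)"
      by (rule LIMSEQ_le[OF 1 2]) (use test in \<open>auto simp: residual_test_def\<close>)
    then show "(\<Sum>i<N. (cmod (?c i))\<^sup>2) \<le> 1 / 4 ^ (l + k)" by simp
  qed
  also have "1 / 4 ^ (l + k) = (1 / 2 ^ (l + k) :: real)\<^sup>2"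
  proof -
    have "(4::real) ^ (l + k) = (2 ^ (l + k))\<^sup>2"
      by (simp add: power2_eq_square flip: power_mult_distrib)
    then show ?thesis by (simp add: power_divide)
  qed
  finally show ?thesis by (rule power2_le_imp_le) simp
qed

lemma Omega_bounded_below:
  assumes "(A, b) \<in> Omega f"
  obtains C where "0 < C" "\<And>x. norm x \<le> C * norm (A x)"
proof -
  have "bij A" "bounded_linear (inv A)"
    using assms by (auto simp: Omega_def bounded_op_def)
  then obtain C where "0 < C" "\<And>y. norm (inv A y) \<le> norm y * C"
    using bounded_linear.pos_bounded by blast
  then have "norm x \<le> C * norm (A x)" for x
    using \<open>bij A\<close> bij_is_inj inv_f_f mult.commute by metis
  with \<open>0 < C\<close> show ?thesis by (rule that)
qed

lemma norm_dispersion: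
  assumes "bounded_op A"
  shows "norm (A (proj m x) - proj (f m) (A (proj m x))) \<le> dispersion f m A * norm x"
proof -
  have A: "bounded_linear A" using assms by (simp add: bounded_op_def)
  have "bounded_linear (\<lambda>x. A (proj m x) - proj (f m) (A (proj m x)))"
    by (intro bounded_linear_sub bounded_linear_compose[OF A bounded_linear_proj]
        bounded_linear_compose[OF bounded_linear_proj])
  then have "norm (A (proj m x) - proj (f m) (A (proj m x))) \<le>
      onorm (\<lambda>x. A (proj m x) - proj (f m) (A (proj m x))) * norm x"
    by (rule onorm)
  also have "\<dots> \<le> dispersion f m A * norm x"
    by (intro mult_right_mono) (auto simp: dispersion_def)
  finally show ?thesis .
qed

text \<open>Write \<open>\<parallel>x\<parallel> \<le> C \<parallel>A x\<parallel>\<close>. Once the dispersion is below \<open>1 / (2 C)\<close>, the part of \<open>A x\<close> outside the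
  cut-off has norm at most \<open>\<parallel>x\<parallel> / (2 C)\<close>, so the part inside still satisfies the bound with \<open>2 C\<close> in
  place of \<open>C\<close>. Any \<open>l\<close> that exceeds the threshold of the dispersion and has \<open>8 C\<^sup>2 \<le> 4\<^sup>l\<close> passes all
  tests; another factor \<open>2\<close> is spent on the approximation.\<close>

lemma bounded_below_test_complete:
  assumes dom: "(A, b) \<in> Omega f" and rep: "input_rep p (A, b)"
  shows "\<exists>l. \<forall>n s. bounded_below_test f p l n s"
proof -
  have A: "bounded_op A" and lim: "(\<lambda>m. dispersion f m A) \<longlonglongrightarrow> 0"
    using dom by (auto simp: Omega_def)
  obtain C where C: "0 < C" "\<And>x. norm x \<le> C * norm (A x)"
    using Omega_bounded_below[OF dom] by metis
  have "0 < 1 / (2 * C)" using C by simp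
  with lim have "\<forall>\<^sub>F m in sequentially. dispersion f m A < 1 / (2 * C)"
    by (rule order_tendstoD)
  then obtain m0 where m0: "\<And>m. m0 \<le> m \<Longrightarrow> dispersion f m A < 1 / (2 * C)"
    by (auto simp: eventually_sequentially)
  obtain l0 where l0: "8 * C\<^sup>2 < 4 ^ l0"
    using real_arch_pow[of 4 "8 * C\<^sup>2"] by auto
  define l where "l = max m0 l0"
  have "(4::real) ^ l0 \<le> 4 ^ l" by (intro power_increasing) (auto simp: l_def)
  with l0 have l: "8 * C\<^sup>2 \<le> 4 ^ l" by linarith
  have "m0 \<le> l" by (simp add: l_def)
  have "bounded_below_test f p l n s" for n s
  proof -
    let ?x = "rat_vec n" and ?m = "Suc (llen n + l)"
    have x: "proj ?m ?x = ?x" by (rule proj_rat_vec) simp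
    have "norm (A ?x - proj (f ?m) (A ?x)) \<le> dispersion f ?m A * norm ?x"
      using norm_dispersion[OF A, of ?m ?x f] x by simp
    also have "\<dots> \<le> 1 / (2 * C) * norm ?x"
      using m0[of ?m] \<open>m0 \<le> l\<close> by (intro mult_right_mono) auto
    finally have "norm (A ?x) \<le> norm (proj (f ?m) (A ?x)) + norm ?x / (2 * C)"
      using norm_triangle_sub[of "A ?x" "proj (f ?m) (A ?x)"] by simp
    then have "C * norm (A ?x) \<le> C * (norm (proj (f ?m) (A ?x)) + norm ?x / (2 * C))"
      using C by (intro mult_left_mono) auto
    then have "norm ?x \<le> C * norm (proj (f ?m) (A ?x)) + norm ?x / 2"
      using C(1) C(2)[of ?x] by (simp add: distrib_left)
    then have "norm ?x \<le> 2 * C * norm (proj (f ?m) (A ?x))" by simp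
    then have "(norm ?x)\<^sup>2 \<le> (2 * C * norm (proj (f ?m) (A ?x)))\<^sup>2"
      by (intro power_mono) auto
    also have "\<dots> = 4 * C\<^sup>2 * (\<Sum>i<f ?m. (cmod (coord (A ?x) (Suc i)))\<^sup>2)"
      by (simp add: power_mult_distrib norm_proj_square)
    also have "\<dots> \<le> 4 * C\<^sup>2 * (\<Sum>i<f ?m. 2 * (cmod (approx_image p s n i))\<^sup>2 + 2 * (slack s n)\<^sup>2)"
      using approx_image_error[OF A rep]
      by (intro mult_left_mono sum_mono cmod_square_perturb) (auto simp: norm_minus_commute)
    also have "\<dots> = 8 * C\<^sup>2 * (\<Sum>i<f ?m. (cmod (approx_image p s n i))\<^sup>2 + (slack s n)\<^sup>2)"
      by (simp add: sum_distrib_left algebra_simps)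
    also have "\<dots> \<le> 4 ^ l * (\<Sum>i<f ?m. (cmod (approx_image p s n i))\<^sup>2 + (slack s n)\<^sup>2)"
      using l by (intro mult_right_mono sum_nonneg) auto
    finally show ?thesis by (simp add: bounded_below_test_def norm_rat_vec_square)
  qed
  then show ?thesis by blast
qed

text \<open>A rational vector that is close enough to \<open>A\<^sup>-\<^sup>1 b\<close> has a residual of at most half the required norm,
  which leaves room for the factor \<open>2\<close> in \<open>cmod_square_perturb\<close>.\<close>

lemma residual_test_complete:
  assumes dom: "(A, b) \<in> Omega f" and rep: "input_rep p (A, b)"
  shows "\<exists>n. \<forall>N s. residual_test p k l n N s"
proof -
  have A: "bounded_op A" and bij: "bij A"
    using dom by (auto simp: Omega_def)
  interpret bounded_linear A using A by (simp add: bounded_op_def)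
  obtain K where K: "0 < K" "\<And>x. norm (A x) \<le> norm x * K"
    using pos_bounded by blast
  have "0 < 1 / (2 ^ (l + k + 1) * K)" using K by simp
  then obtain n where n: "norm (rat_vec n - inv A b) < 1 / (2 ^ (l + k + 1) * K)"
    using rat_vec_dense by blast
  have "norm (b - A (rat_vec n)) = norm (A (rat_vec n - inv A b))"
    using bij by (simp add: diff bij_is_surj surj_f_inv_f norm_minus_commute)
  also have "\<dots> \<le> norm (rat_vec n - inv A b) * K" by (rule K)
  also have "\<dots> \<le> 1 / 2 ^ (l + k + 1)"
    using n K by (simp add: field_simps)
  finally have "(norm (b - A (rat_vec n)))\<^sup>2 \<le> (1 / 2 ^ (l + k + 1))\<^sup>2"
    by (intro power_mono) auto
  also have "\<dots> = 1 / (4 * 4 ^ (l + k))"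
  proof -
    have "(4::real) ^ (l + k) = (2 ^ (l + k))\<^sup>2"
      by (simp add: power2_eq_square flip: power_mult_distrib)
    then show ?thesis by (simp add: power_divide power_mult_distrib)
  qed
  finally have u: "2 * (norm (b - A (rat_vec n)))\<^sup>2 \<le> 1 / 4 ^ (l + k)" by (simp add: field_simps)
  have "residual_test p k l n N s" for N s
  proof -
    have "(\<Sum>i<N. (cmod (approx_b p s i - approx_image p s n i))\<^sup>2) \<le>
        (\<Sum>i<N. 2 * (cmod (coord (b - A (rat_vec n)) (Suc i)))\<^sup>2 + 2 * (slack s n)\<^sup>2)"
      by (intro sum_mono cmod_square_perturb residual_error[OF A rep])
    also have "\<dots> = 2 * (\<Sum>i<N. (cmod (coord (b - A (rat_vec n)) (Suc i)))\<^sup>2) + (\<Sum>i<N. 2 * (slack s n)\<^sup>2)"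
      by (simp add: sum.distrib sum_distrib_left)
    also have "\<dots> \<le> 1 / 4 ^ (l + k) + (\<Sum>i<N. 2 * (slack s n)\<^sup>2)"
      using u norm_ell2_ge_partial[where x = "b - A (rat_vec n)" and N = N] by linarith
    finally show ?thesis by (simp add: residual_test_def)
  qed
  then show ?thesis by blast
qed

subsection \<open>Searching in the limit\<close>

text \<open>At stage \<open>s\<close>, with candidates \<open>t < s\<close> and tests \<open>\<sigma> < s\<close>, the sum counts the candidates that precede
  all surviving ones. The finitely many wrong candidates before the first correct one are refuted at
  some stage, and from then on the count is the index of the first correct one.\<close>

lemma first_unrefuted:
  assumes "\<exists>t. \<forall>\<sigma>. R t \<sigma>"
  shows "\<forall>\<^sub>F s in sequentially.
    (\<Sum>t<s. of_bool (\<forall>u<Suc t. \<not> (\<forall>\<sigma><s. R u \<sigma>))) = (LEAST t. \<forall>\<sigma>. R t (\<sigma>::nat))"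
proof -
  define t0 where "t0 = (LEAST t. \<forall>\<sigma>. R t \<sigma>)"
  have t0: "\<forall>\<sigma>. R t0 \<sigma>" unfolding t0_def using assms by (rule LeastI_ex)
  have "\<forall>u<t0. \<exists>\<sigma>. \<not> R u \<sigma>" unfolding t0_def using not_less_Least by blast
  then obtain w where w: "\<And>u. u < t0 \<Longrightarrow> \<not> R u (w u)" by metis
  define S where "S = t0 + (\<Sum>u<t0. Suc (w u))"
  have "(\<Sum>t<s. of_bool (\<forall>u<Suc t. \<not> (\<forall>\<sigma><s. R u \<sigma>))) = t0" if "S \<le> s" for s
  proof -
    have w_less: "w u < s" if "u < t0" for u
    proof -
      have "Suc (w u) \<le> (\<Sum>u<t0. Suc (w u))"
        using that by (intro member_le_sum) auto
      then show ?thesis using \<open>S \<le> s\<close> unfolding S_def by linarith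
    qed
    have "(\<forall>u<Suc t. \<not> (\<forall>\<sigma><s. R u \<sigma>)) \<longleftrightarrow> t < t0" for t
    proof
      assume "\<forall>u<Suc t. \<not> (\<forall>\<sigma><s. R u \<sigma>)"
      then show "t < t0" using t0 by (meson not_less_eq)
    next
      assume "t < t0"
      then show "\<forall>u<Suc t. \<not> (\<forall>\<sigma><s. R u \<sigma>)"
        using w w_less by (metis less_Suc_eq less_trans)
    qed
    moreover have "{t. t < s \<and> t < t0} = {..<t0}" using that by (auto simp: S_def)
    ultimately show ?thesis by (simp add: Int_def)
  qed
  then show ?thesis
    unfolding t0_def[symmetric] eventually_sequentially by blast
qed

lemma Lim_baire_eqI:
  assumes "\<And>j. \<forall>\<^sub>F s in sequentially. P (prod_encode (s, j)) = r j"
  shows "Lim_baire P = Some r"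
proof -
  have "lim (\<lambda>s. P (prod_encode (s, j))) = r j" for j
    using assms[of j] by (intro limI tendsto_eventually)
  then show ?thesis
    unfolding Lim_baire_def using assms by auto
qed

text \<open>A candidate codes a pair of an exponent \<open>l\<close> and a rational vector; a test codes a triple of a
  vector, a number of coordinates and a precision.\<close>

definition passes :: "(nat \<Rightarrow> nat) \<Rightarrow> baire \<Rightarrow> nat \<Rightarrow> nat \<Rightarrow> nat \<Rightarrow> bool" where
  "passes f p k t \<sigma> \<longleftrightarrow>
    bounded_below_test f p (pfst t) (pfst \<sigma>) (psnd (psnd \<sigma>)) \<and>
    residual_test p k (pfst t) (psnd t) (pfst (psnd \<sigma>)) (psnd (psnd \<sigma>))"

definition solver :: "(nat \<Rightarrow> nat) \<Rightarrow> baire \<Rightarrow> baire" where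
  "solver f p m =
    psnd (\<Sum>t<pfst m. of_bool (\<forall>u<Suc t. \<not> (\<forall>\<sigma><pfst m. passes f p (psnd m) u \<sigma>)))"

lemma passes_all_iff:
  "(\<forall>\<sigma>. passes f p k t \<sigma>) \<longleftrightarrow> (\<forall>n s. bounded_below_test f p (pfst t) n s) \<and>
    (\<forall>N s. residual_test p k (pfst t) (psnd t) N s)"
proof -
  have "(\<forall>\<sigma>. Q (pfst \<sigma>) (pfst (psnd \<sigma>)) (psnd (psnd \<sigma>))) \<longleftrightarrow> (\<forall>n N s. Q n N s)" for Q
    by (metis pfst_prod_encode psnd_prod_encode)
  from this[of "\<lambda>n N s. bounded_below_test f p (pfst t) n s \<and> residual_test p k (pfst t) (psnd t) N s"]
  show ?thesis unfolding passes_def by blast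
qed

text \<open>For the accepted candidate \<open>(l, v)\<close> the lower bound on \<open>A\<close> is applied to \<open>v - A\<^sup>-\<^sup>1 b\<close>, whose image is
  the negative residual.\<close>

lemma solver_correct:
  assumes dom: "(A, b) \<in> Omega f" and rep: "input_rep p (A, b)"
  shows "\<exists>r. Lim_baire (solver f p) = Some r \<and> delta_H r (inv A b)"
proof -
  have A: "bounded_op A" and bij: "bij A"
    using dom by (auto simp: Omega_def)
  interpret bounded_linear A using A by (simp add: bounded_op_def)
  have ex: "\<exists>t. \<forall>\<sigma>. passes f p k t \<sigma>" for k
  proof -
    obtain l where l: "\<forall>n s. bounded_below_test f p l n s"
      using bounded_below_test_complete[OF dom rep] by blast
    obtain n where "\<forall>N s. residual_test p k l n N s"
      using residual_test_complete[OF dom rep] by blast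
    with l show ?thesis
      unfolding passes_all_iff by (intro exI[of _ "prod_encode (l, n)"]) simp
  qed
  define T where "T k = (LEAST t. \<forall>\<sigma>. passes f p k t \<sigma>)" for k
  have "Lim_baire (solver f p) = Some (\<lambda>k. psnd (T k))"
  proof (rule Lim_baire_eqI)
    fix k
    show "\<forall>\<^sub>F s in sequentially. solver f p (prod_encode (s, k)) = psnd (T k)"
      using first_unrefuted[OF ex, of k]
      by eventually_elim (simp add: solver_def T_def)
  qed
  moreover have "delta_H (\<lambda>k. psnd (T k)) (inv A b)"
    unfolding delta_H_def
  proof
    fix k
    let ?v = "rat_vec (psnd (T k))" and ?l = "pfst (T k)"
    have T: "\<forall>\<sigma>. passes f p k (T k) \<sigma>"
      unfolding T_def using ex by (rule LeastI_ex)
    then have "norm (?v - inv A b) \<le> 2 ^ ?l * norm (A (?v - inv A b))"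
        by (intro bounded_below_testD[OF A rep, where f = f]) (simp add: passes_all_iff)
    also have "norm (A (?v - inv A b)) = norm (b - A ?v)"
      using bij by (simp add: diff bij_is_surj surj_f_inv_f norm_minus_commute)
    also have "2 ^ ?l * norm (b - A ?v) \<le> 2 ^ ?l * (1 / 2 ^ (?l + k))"
      using T by (intro mult_left_mono residual_testD[OF A rep]) (simp_all add: passes_all_iff)
    also have "\<dots> = 1 / 2 ^ k" by (simp add: power_add)
    finally show "norm (?v - inv A b) \<le> 1 / 2 ^ k" .
  qed
  ultimately show ?thesis by blast
qed

text \<open>The cut-offs in the tests are values \<open>f (Suc n)\<close>, which computability of \<open>f\<close> on positive arguments
  supplies; everything else is exact rational arithmetic.\<close>

lemma crec_solver:
  assumes f: "\<And>F. crec F \<Longrightarrow> crec (\<lambda>p x. f (Suc (F p x)))"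
  shows "crec (solver f)"
proof -
  have A: "crec S \<Longrightarrow> crec I \<Longrightarrow> crec J \<Longrightarrow> crec_cx (\<lambda>p x. approx_A p (S p x) (I p x) (J p x))" for S I J
    unfolding approx_A_def by (intro crec_cx_Complex crec_rat_basic crec_basic)
  have b: "crec S \<Longrightarrow> crec I \<Longrightarrow> crec_cx (\<lambda>p x. approx_b p (S p x) (I p x))" for S I
    unfolding approx_b_def by (intro crec_cx_Complex crec_rat_basic crec_basic)
  have approx_image_paired: "crec_cx (\<lambda>p x. approx_image p (pfst x) (pfst (psnd x)) (psnd (psnd x)))"
    unfolding approx_image_def
    by (intro crec_cx_sum crec_cx_mult A crec_cx_rat_complex crec_llen crec_lnth crec_basic)
  have approx_image: "crec_cx (\<lambda>p x. approx_image p (S p x) (N p x) (I p x))"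
    if "crec S" "crec N" "crec I" for S N I
    using crec_cx_comp[OF approx_image_paired, of "\<lambda>p x. prod_encode (S p x, prod_encode (N p x, I p x))"] that
    by (simp add: crec_pair)
  have slack_paired: "crec_rat (\<lambda>p x. slack (pfst x) (psnd x))"
    unfolding slack_def
    by (intro crec_rat_cmod_square crec_cx_rat_complex crec_rat_basic crec_llen crec_lnth crec_basic)
  have slack: "crec_rat (\<lambda>p x. slack (S p x) (N p x))" if "crec S" "crec N" for S N
    using crec_rat_comp[OF slack_paired, of "\<lambda>p x. prod_encode (S p x, N p x)"] that
    by (simp add: crec_pair)
  show ?thesis
    unfolding solver_def[abs_def] passes_def bounded_below_test_def residual_test_def
    by (intro approx_image slack b f crec_rat_real crec_rat_cmod_square crec_cx_diff crec_cx_rat_complex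
        crec_rat_basic crec_llen crec_lnth crec_basic)
qed

section \<open>Computing one limit by solving\<close>

lemma id_in_Omega:
  assumes "\<And>m. m \<ge> 1 \<Longrightarrow> f m \<ge> m"
  shows "(id, b) \<in> Omega f"
proof -
  have "dispersion f m id = 0" if "m \<ge> 1" for m
  proof -
    have "proj (f m) (proj m x) = proj m x" "proj m (x - proj (f m) x) = 0" for x
      using assms[OF that] by (auto intro!: ell2_eqI simp: coord_proj)
    then show ?thesis by (simp add: dispersion_def onorm_zero)
  qed
  then have "(\<lambda>m. dispersion f m id) \<longlonglongrightarrow> 0"
    by (intro tendsto_eventually) (auto simp: eventually_sequentially)
  moreover have "bounded_op id"
    by (simp add: bounded_op_def bounded_linear_ident[folded id_def])
  ultimately show ?thesis by (simp add: Omega_def inv_id)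
qed

text \<open>The rational \<open>1 / 2\<^sup>m\<close>: the integers \<open>1\<close> and \<open>2\<^sup>m\<close> have the codes \<open>2\<close> and \<open>2 \<cdot> 2\<^sup>m\<close>.\<close>

definition pow_code :: "nat \<Rightarrow> nat" where
  "pow_code m = prod_encode (2, 2 * 2 ^ m)"

lemma rat_code_pow_code [simp]: "rat_code (pow_code m) = 1 / 2 ^ m"
  by (simp add: rat_code_eq pow_code_def int_decode_eq_if)

lemma rat_code_0 [simp]: "rat_code 0 = 0"
proof -
  have "pfst 0 = 0" using pfst_le[of 0] by simp
  then show ?thesis by (simp add: rat_code_eq int_decode_eq_if)
qed

text \<open>A name of \<open>(I, b)\<close> for the vector \<open>b\<close> whose coordinates are the rationals with codes \<open>c i\<close>. Every
  approximation is exact, so it is independent of the precision.\<close>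

definition identity_name :: "(nat \<Rightarrow> nat) \<Rightarrow> baire" where
  "identity_name c n =
    (if even n
     then if pfst (n div 2) = pfst (psnd (n div 2)) \<and> even (psnd (psnd (n div 2)))
          then pow_code 0 else 0
     else if even (psnd (n div 2)) then c (pfst (n div 2)) else 0)"

lemma input_rep_identity_name:
  assumes "\<And>i. coord b (Suc i) = of_real (rat_code (c i))"
  shows "input_rep (identity_name c) (id, b)"
proof -
  have real: "real_rep p x" if "\<And>n. rat_code (p n) = x" for p x
    using that by (simp add: real_rep_def rat_code_def)
  have "complex_rep (\<lambda>n. evens (identity_name c) (prod_encode (i, prod_encode (j, n))))
      (evalA (Suc i) (Suc j) (id, b))" for i j
    unfolding complex_rep_def
    by (intro conjI real) (auto simp: evens_def odds_def identity_name_def cinner_basis coord_basis)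
  moreover have "complex_rep (\<lambda>n. odds (identity_name c) (prod_encode (i, n))) (evalb (Suc i) (id, b))" for i
    unfolding complex_rep_def
    by (intro conjI real) (auto simp: evens_def odds_def identity_name_def cinner_basis assms)
  ultimately show ?thesis
    by (simp add: input_rep_def seq_rep_def del: evalA.simps evalb.simps)
qed

definition changes :: "baire \<Rightarrow> nat \<Rightarrow> nat \<Rightarrow> bool" where
  "changes P j s \<longleftrightarrow> P (prod_encode (Suc s, j)) \<noteq> P (prod_encode (s, j))"

definition change_count :: "baire \<Rightarrow> nat \<Rightarrow> nat \<Rightarrow> nat" where
  "change_count P j s = (\<Sum>u<s. of_bool (changes P j u))"

text \<open>A coordinate that marks a change has weight \<open>1 / 2\<^sup>j\<^sup>+\<^sup>c\<close> with \<open>c\<close> the number of earlier changes in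
  column \<open>j\<close>. No weight is used twice within a column, so the squares are summable however often the
  columns change; yet the weight of the next change can be predicted from the changes so far.\<close>

definition change_code :: "baire \<Rightarrow> nat \<Rightarrow> nat" where
  "change_code P i = (if changes P (psnd i) (pfst i)
     then pow_code (psnd i + change_count P (psnd i) (pfst i)) else 0)"

lemma geometric_quarter: "(\<Sum>c<m. (1 / 4 :: real) ^ c) \<le> 2"
proof -
  have "(\<Sum>c<m. (1 / 4 :: real) ^ c) = (1 - (1 / 4) ^ m) / (3 / 4)"
    by (subst sum_gp_strict) simp
  also have "\<dots> \<le> 2" by (simp add: field_simps)
  finally show ?thesis .
qed

text \<open>Summed over stages, column \<open>j\<close> contributes \<open>1 / 4\<^sup>j\<close> times a partial sum of the geometric series
  in \<open>1 / 4\<close>, because the exponent runs through \<open>0, 1, 2, \<dots>\<close> as the changes occur.\<close>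

lemma change_code_square_sum: "(\<Sum>i<n. (rat_code (change_code P i))\<^sup>2) \<le> 4"
proof -
  let ?w = "\<lambda>i. (rat_code (change_code P i))\<^sup>2"
  have w: "?w (prod_encode (s, j)) =
      (1 / 4) ^ j * (of_bool (changes P j s) * (1 / 4) ^ change_count P j s)" for s j
  proof -
    have "(4::real) ^ k = 2 ^ k * 2 ^ k" for k
      by (simp flip: power_mult_distrib)
    then show ?thesis
      by (simp add: change_code_def power2_eq_square power_add power_divide)
  qed
  have column: "(\<Sum>s<n. of_bool (changes P j s) * (1 / 4 :: real) ^ change_count P j s) =
      (\<Sum>c<change_count P j n. (1 / 4) ^ c)" for j n
    by (induction n) (auto simp: change_count_def)
  have "i \<in> prod_encode ` ({..<n} \<times> {..<n})" if "i < n" for i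
    using that pfst_le[of i] psnd_le[of i]
    by (intro image_eqI[of _ _ "(pfst i, psnd i)"]) auto
  then have "(\<Sum>i<n. ?w i) \<le> (\<Sum>i\<in>prod_encode ` ({..<n} \<times> {..<n}). ?w i)"
    by (intro sum_mono2) auto
  also have "\<dots> = (\<Sum>(s, j)\<in>{..<n} \<times> {..<n}. ?w (prod_encode (s, j)))"
    by (simp add: sum.reindex inj_prod_encode case_prod_unfold)
  also have "\<dots> = (\<Sum>s<n. \<Sum>j<n. ?w (prod_encode (s, j)))"
    by (rule sum.cartesian_product[symmetric])
  also have "\<dots> = (\<Sum>j<n. \<Sum>s<n. ?w (prod_encode (s, j)))"
    by (rule sum.swap)
  also have "\<dots> = (\<Sum>j<n. (1 / 4) ^ j * (\<Sum>c<change_count P j n. (1 / 4) ^ c))"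
    unfolding w sum_distrib_left[symmetric] column ..
  also have "\<dots> \<le> (\<Sum>j<n. (1 / 4) ^ j * 2)"
    by (intro sum_mono mult_left_mono geometric_quarter) simp
  also have "\<dots> \<le> 2 * 2"
    unfolding sum_distrib_right[symmetric] by (intro mult_right_mono geometric_quarter) simp
  finally show ?thesis by simp
qed

definition change_vec :: "baire \<Rightarrow> ell2" where
  "change_vec P = Abs_ell2 (case_nat 0 (\<lambda>i. of_real (rat_code (change_code P i))))"

lemma coord_change_vec: "coord (change_vec P) (Suc i) = of_real (rat_code (change_code P i))"
proof -
  let ?x = "case_nat 0 (\<lambda>i. of_real (rat_code (change_code P i))) :: nat \<Rightarrow> complex"
  have "summable (\<lambda>i. (cmod (?x (Suc i)))\<^sup>2)"
    by (rule bounded_imp_summable[of _ 4])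
      (use change_code_square_sum[of P "Suc _"] in \<open>auto simp: lessThan_Suc_atMost\<close>)
  then have "summable (\<lambda>i. (cmod (?x i))\<^sup>2)"
    by (subst (asm) summable_Suc_iff)
  then show ?thesis
    by (simp add: change_vec_def coord_Abs_ell2)
qed

text \<open>Let \<open>L\<close> be the length of the vector that approximates \<open>change_vec P\<close> up to \<open>1 / 2\<^sup>j\<^sup>+\<^sup>c\<^sup>+\<^sup>1\<close>. All
  coordinates beyond \<open>L\<close> are bounded by this number. The first change at or after stage \<open>L\<close> would
  have at most \<open>c\<close> predecessors, hence a weight of at least \<open>1 / 2\<^sup>j\<^sup>+\<^sup>c\<close>, and its coordinate would lie
  beyond \<open>L\<close>.\<close>

lemma settled_from_name:
  assumes name: "delta_H q (change_vec P)"
    and few: "change_count P j (llen (q (j + c + 1))) \<le> c"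
  shows "s \<ge> llen (q (j + c + 1)) \<Longrightarrow> \<not> changes P j s"
proof (rule notI)
  let ?L = "llen (q (j + c + 1))"
  assume "?L \<le> s" "changes P j s"
  define s0 where "s0 = (LEAST s. ?L \<le> s \<and> changes P j s)"
  have s0: "?L \<le> s0" "changes P j s0"
    using LeastI[of "\<lambda>s. ?L \<le> s \<and> changes P j s" s] \<open>?L \<le> s\<close> \<open>changes P j s\<close>
    unfolding s0_def by auto
  have "\<not> changes P j u" if "?L \<le> u" "u < s0" for u
    using that not_less_Least[of u "\<lambda>s. ?L \<le> s \<and> changes P j s"] unfolding s0_def by blast
  then have "change_count P j s0 = change_count P j ?L"
    unfolding change_count_def using s0(1)
    by (intro sum.mono_neutral_right) auto
  with few have count: "change_count P j s0 \<le> c" by simp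
  let ?i = "prod_encode (s0, j)"
  have "?L \<le> ?i" using s0(1) le_prod_encode_1[of s0 j] by linarith
  then have "cmod (coord (rat_vec (q (j + c + 1)) - change_vec P) (Suc ?i)) =
      1 / 2 ^ (j + change_count P j s0)"
    using s0(2) by (simp add: coord_rat_vec coord_change_vec change_code_def norm_divide norm_power)
  moreover have "cmod (coord (rat_vec (q (j + c + 1)) - change_vec P) (Suc ?i)) \<le> 1 / 2 ^ (j + c + 1)"
    using cmod_coord_le_norm name unfolding delta_H_def by (meson order_trans)
  ultimately have "(1::real) / 2 ^ (j + change_count P j s0) \<le> 1 / 2 ^ (j + c + 1)" by simp
  then have "(2::real) ^ (j + c + 1) \<le> 2 ^ (j + change_count P j s0)"
    by (simp add: field_simps)
  then have "j + c + 1 \<le> j + change_count P j s0"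
    by (subst (asm) power_increasing_iff) auto
  with count show False by simp
qed

lemma Lim_baireD:
  assumes "Lim_baire P = Some r"
  shows "\<forall>\<^sub>F s in sequentially. P (prod_encode (s, j)) = r j"
proof -
  have *: "\<forall>j. \<exists>v. \<forall>\<^sub>F s in sequentially. P (prod_encode (s, j)) = v"
    and r: "r = (\<lambda>j. lim (\<lambda>s. P (prod_encode (s, j))))"
    using assms by (auto simp: Lim_baire_def split: if_splits)
  from * obtain v where v: "\<forall>\<^sub>F s in sequentially. P (prod_encode (s, j)) = v" by blast
  then have "r j = v" unfolding r by (intro limI tendsto_eventually)
  with v show ?thesis by simp
qed

text \<open>A stage from which on a column is constant bounds the number of its changes and is therefore a
  possible \<open>c\<close>; this is why the unbounded search in the decoder ends.\<close>

lemma few_changes_exists: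
  assumes "\<forall>\<^sub>F s in sequentially. P (prod_encode (s, j)) = v"
  shows "\<exists>c. change_count P j (llen (q (j + c + 1))) \<le> c"
proof -
  obtain S where S: "\<And>s. S \<le> s \<Longrightarrow> P (prod_encode (s, j)) = v"
    using assms by (auto simp: eventually_sequentially)
  have "change_count P j s \<le> S" for s
  proof -
    have "{u. u < s \<and> changes P j u} \<subseteq> {..<S}"
      using S unfolding changes_def by (auto simp: not_less intro: ccontr)
    from card_mono[OF _ this] show ?thesis
      by (simp add: change_count_def Int_def)
  qed
  then show ?thesis by blast
qed

lemma value_when_settled:
  assumes "\<And>s. s \<ge> L \<Longrightarrow> \<not> changes P j s"
    and "\<forall>\<^sub>F s in sequentially. P (prod_encode (s, j)) = v"
  shows "P (prod_encode (L, j)) = v"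
proof -
  have "P (prod_encode (L + d, j)) = P (prod_encode (L, j))" for d
    using assms(1)[of "L + d" for d] by (induction d) (auto simp: changes_def)
  then have "P (prod_encode (s, j)) = P (prod_encode (L, j))" if "s \<ge> L" for s
    using that le_Suc_ex by blast
  moreover obtain S where "\<And>s. S \<le> s \<Longrightarrow> P (prod_encode (s, j)) = v"
    using assms(2) by (auto simp: eventually_sequentially)
  ultimately show ?thesis by (metis max.cobounded1 max.cobounded2)
qed

lemma join_even [simp]: "join p q (2 * n) = p n"
  and join_odd [simp]: "join p q (2 * n + 1) = q n" "join p q (Suc (2 * n)) = q n"
  by (simp_all add: join_def)

text \<open>Search for a \<open>c\<close> as in \<open>settled_from_name\<close> and read off the column at the stage where it is known
  to have settled.\<close>

lemma limit_decoder:
  "\<exists>e. \<forall>P q r. Lim_baire P = Some r \<longrightarrow> delta_H q (change_vec P) \<longrightarrow>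
    functional e (join P q) = Some r"
proof -
  define G where "G = (\<lambda>h y. of_bool (\<not> change_count (evens h) (psnd y)
      (llen (odds h (psnd y + pfst y + 1))) \<le> pfst y) :: nat)"
  define V where "V = (\<lambda>h y. evens h (prod_encode (llen (odds h (psnd y + pfst y + 1)), psnd y)))"
  have "crec G" "crec V"
    unfolding G_def V_def evens_def odds_def change_count_def changes_def
    by (intro crec_basic crec_llen)+
  from run_search[OF this] obtain e where e: "\<And>p x. \<exists>c. G p (prod_encode (c, x)) = 0 \<Longrightarrow>
    run e p [x] = Some (V p (prod_encode (LEAST c. G p (prod_encode (c, x)) = 0, x)))" by blast
  show ?thesis
  proof (intro exI allI impI)
    fix P q r assume lim: "Lim_baire P = Some r" and name: "delta_H q (change_vec P)"
    have parts: "evens (join P q) = P" "odds (join P q) = q"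
      by (simp_all add: evens_def odds_def fun_eq_iff)
    have "run e (join P q) [j] = Some (r j)" for j
    proof -
      let ?ok = "\<lambda>c. change_count P j (llen (q (j + c + 1))) \<le> c"
      have G: "G (join P q) (prod_encode (c, j)) = 0 \<longleftrightarrow> ?ok c" for c
        by (simp add: G_def parts)
      have ex: "\<exists>c. ?ok c" using few_changes_exists[OF Lim_baireD[OF lim]] .
      define c where "c = (LEAST c. ?ok c)"
      have "?ok c" unfolding c_def using ex by (rule LeastI_ex)
      from value_when_settled[OF settled_from_name[OF name this] Lim_baireD[OF lim]]
      have "P (prod_encode (llen (q (j + c + 1)), j)) = r j" .
      moreover have "run e (join P q) [j] = Some (V (join P q) (prod_encode (c, j)))"
        using e[of "join P q" j] ex unfolding G c_def by blast
      ultimately show ?thesis by (simp add: V_def parts)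
    qed
    then show "functional e (join P q) = Some r"
      by (simp add: functional_def)
  qed
qed

lemma crec_identity_name: "crec (\<lambda>P. identity_name (change_code P))"
  unfolding identity_name_def[abs_def] change_code_def change_count_def changes_def pow_code_def
  by (intro crec_basic)

text \<open>The decoder receives \<open>P\<close> itself along with the solution, since it has to inspect the columns.\<close>

lemma Lim_le_Solve:
  assumes "\<And>m. m \<ge> 1 \<Longrightarrow> f m \<ge> m"
  shows "baire_problem Lim_baire \<le>\<^sub>W Solve f"
proof -
  from limit_decoder obtain e where e: "\<forall>P q r. Lim_baire P = Some r \<longrightarrow>
    delta_H q (change_vec P) \<longrightarrow> functional e (join P q) = Some r" ..
  let ?K = "\<lambda>P. Some (identity_name (change_code P))"
  let ?H = "\<lambda>p q. functional e (join p q)"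
  have "realizes (\<lambda>p. Option.bind (?K p) (\<lambda>q. Option.bind (G q) (?H p))) (baire_problem Lim_baire)"
    if G: "realizes G (Solve f)" for G
    unfolding realizes_def
  proof (intro allI impI)
    fix p u
    assume *: "sols (baire_problem Lim_baire) u \<noteq> {} \<and> in_rep (baire_problem Lim_baire) p u"
    then have u: "u = p" by (simp add: baire_problem_def)
    with * obtain r where r: "Lim_baire p = Some r"
      by (cases "Lim_baire p") (simp_all add: baire_problem_def)
    have sols: "sols (Solve f) (id, change_vec p) = {change_vec p}"
      using id_in_Omega[OF assms] by (simp add: Solve_def)
    have "input_rep (identity_name (change_code p)) (id, change_vec p)"
      using coord_change_vec by (rule input_rep_identity_name)
    then have "in_rep (Solve f) (identity_name (change_code p)) (id, change_vec p)"
      by (simp add: Solve_def)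
    with G sols obtain q v where "G (identity_name (change_code p)) = Some q" "out_rep (Solve f) q v"
      "v = change_vec p"
      unfolding realizes_def by (metis empty_not_insert singletonD)
    then have "G (identity_name (change_code p)) = Some q" "delta_H q (change_vec p)"
      by (simp_all add: Solve_def)
    then show "\<exists>q v. Option.bind (?K p) (\<lambda>q. Option.bind (G q) (?H p)) = Some q \<and>
        out_rep (baire_problem Lim_baire) q v \<and> v \<in> sols (baire_problem Lim_baire) u"
      using e[rule_format, OF r] r u by (simp add: baire_problem_def)
  qed
  moreover have "computable ?K" by (intro crec_computable crec_identity_name)
  moreover have "computable2 ?H" 
    unfolding computable2_def computable_def by (intro exI[of _ "functional e"] conjI exI[of _ e] refl)
  ultimately show ?thesis
    unfolding weihrauch_le_def by (intro exI[of _ ?K] exI[of _ ?H] conjI allI impI)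
qed

section \<open>Solving is not continuous\<close>

text \<open>In this form the condition mentions only the finitely many calls that the search has made.\<close>

lemma run_Mu_iff:
  "run (Mu g) p xs = Some n \<longleftrightarrow>
    run g p (n # xs) = Some 0 \<and> (\<forall>k<n. \<exists>v. run g p (k # xs) = Some (Suc v))"
proof
  assume R: "run (Mu g) p xs = Some n"
  then obtain m where m: "run g p (m # xs) = Some 0" "\<forall>k<m. run g p (k # xs) \<noteq> None"
    and n: "n = (LEAST n. run g p (n # xs) = Some 0)"
    by (auto split: if_splits)
  have "run g p (n # xs) = Some 0" unfolding n using m(1) by (rule LeastI)
  moreover have "n \<le> m" unfolding n using m(1) by (rule Least_le)
  moreover have "run g p (k # xs) \<noteq> Some 0" if "k < n" for k
    using that not_less_Least unfolding n by blast
  ultimately show "run g p (n # xs) = Some 0 \<and> (\<forall>k<n. \<exists>v. run g p (k # xs) = Some (Suc v))"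
    using m(2) by (metis less_le_trans not0_implies_Suc option.exhaust)
next
  assume R: "run g p (n # xs) = Some 0 \<and> (\<forall>k<n. \<exists>v. run g p (k # xs) = Some (Suc v))"
  then have "(LEAST n. run g p (n # xs) = Some 0) = n"
    by (intro Least_equality) (auto intro: leI)
  moreover have "\<exists>n. run g p (n # xs) = Some 0 \<and> (\<forall>k<n. run g p (k # xs) \<noteq> None)"
    using R by (intro exI[of _ n]) auto
  ultimately show "run (Mu g) p xs = Some n" by simp
qed

text \<open>A terminating computation asks finitely many questions. Stating this for all large \<open>N\<close> lets the
  bounds of finitely many subcomputations be combined by filter reasoning.\<close>

lemma run_finite_use:
  "run e p xs = Some y \<Longrightarrow>
    \<forall>\<^sub>F N in sequentially. \<forall>p'. (\<forall>i<N. p' i = p i) \<longrightarrow> run e p' xs = Some y"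
proof (induction e arbitrary: xs y)
  case Orac
  then obtain x where "xs \<noteq> []" "y = p (hd xs)" by (auto split: list.splits)
  then show ?case
    by (intro eventually_mono[OF eventually_gt_at_top[of "hd xs"]]) (auto split: list.splits)
next
  case (Comp g hs)
  let ?ys = "map (\<lambda>h. run h p xs) hs"
  have none: "None \<notin> set ?ys" and g: "run g p (map the ?ys) = Some y"
    using Comp.prems by (auto simp: Let_def split: if_splits)
  have "\<forall>h\<in>set hs. \<forall>\<^sub>F N in sequentially. \<forall>p'. (\<forall>i<N. p' i = p i) \<longrightarrow> run h p' xs = run h p xs"
  proof
    fix h assume h: "h \<in> set hs"
    then obtain v where v: "run h p xs = Some v" using none by (cases "run h p xs") force+
    show "\<forall>\<^sub>F N in sequentially. \<forall>p'. (\<forall>i<N. p' i = p i) \<longrightarrow> run h p' xs = run h p xs"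
      using Comp.IH(2)[OF h v] v by simp
  qed
  then have "\<forall>\<^sub>F N in sequentially. \<forall>h\<in>set hs. \<forall>p'. (\<forall>i<N. p' i = p i) \<longrightarrow> run h p' xs = run h p xs"
    by (intro eventually_ball_finite) auto
  with Comp.IH(1)[OF g] show ?case
  proof eventually_elim
    case (elim N)
    show ?case
    proof (intro allI impI)
      fix p' assume p': "\<forall>i<N. p' i = p i"
      with elim(2) have ys: "map (\<lambda>h. run h p' xs) hs = ?ys"
        by (intro map_cong refl) blast
      show "run (Comp g hs) p' xs = Some y"
        unfolding run.simps Let_def ys if_not_P[OF none] using elim(1) p' by blast
    qed
  qed
next
  case (Prec g h)
  from Prec.prems obtain n zs where xs: "xs = n # zs" by (cases xs) auto
  have "run (Prec g h) p (n # zs) = Some y \<Longrightarrow>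
    \<forall>\<^sub>F N in sequentially. \<forall>p'. (\<forall>i<N. p' i = p i) \<longrightarrow> run (Prec g h) p' (n # zs) = Some y" for y
  proof (induction n arbitrary: y)
    case 0
    then show ?case using Prec.IH(1)[of zs y] by simp
  next
    case (Suc n)
    then obtain v where v: "run (Prec g h) p (n # zs) = Some v" "run h p (n # v # zs) = Some y"
      by (auto simp: bind_eq_Some_conv)
    from Suc.IH[OF v(1)] Prec.IH(2)[OF v(2)] show ?case
      by eventually_elim simp
  qed
  then show ?case using Prec.prems xs by blast
next
  case (Mu g)
  from Mu.prems have 0: "run g p (y # xs) = Some 0"
    and S: "\<forall>k<y. \<exists>v. run g p (k # xs) = Some (Suc v)"
    unfolding run_Mu_iff by auto
  have "\<forall>k\<in>{..<y}. \<forall>\<^sub>F N in sequentially. \<forall>p'. (\<forall>i<N. p' i = p i) \<longrightarrow> run g p' (k # xs) = run g p (k # xs)"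
  proof
    fix k assume "k \<in> {..<y}"
    then obtain v where "run g p (k # xs) = Some (Suc v)" using S by auto
    with Mu.IH[OF this] show "\<forall>\<^sub>F N in sequentially. \<forall>p'. (\<forall>i<N. p' i = p i) \<longrightarrow> run g p' (k # xs) = run g p (k # xs)"
      by simp
  qed
  then have "\<forall>\<^sub>F N in sequentially. \<forall>k\<in>{..<y}. \<forall>p'. (\<forall>i<N. p' i = p i) \<longrightarrow> run g p' (k # xs) = run g p (k # xs)"
    by (intro eventually_ball_finite) auto
  with Mu.IH[OF 0] show ?case
  proof eventually_elim
    case (elim N)
    show ?case
    proof (intro allI impI)
      fix p' assume p': "\<forall>i<N. p' i = p i"
      then have "run g p' (y # xs) = Some 0" and "\<And>k. k < y \<Longrightarrow> run g p' (k # xs) = run g p (k # xs)"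
        using elim by blast+
      then show "run (Mu g) p' xs = Some y"
        unfolding run_Mu_iff using S by metis
    qed
  qed
qed (simp_all split: list.splits if_splits)

text \<open>Continuity of a partial functional on its domain: each output is fixed by a finite prefix of the
  input among all inputs on which the functional is defined.\<close>

definition finite_use :: "(baire \<Rightarrow> baire option) \<Rightarrow> bool" where
  "finite_use F \<longleftrightarrow> (\<forall>p q n. F p = Some q \<longrightarrow>
    (\<forall>\<^sub>F N in sequentially. \<forall>p' q'. (\<forall>i<N. p' i = p i) \<longrightarrow> F p' = Some q' \<longrightarrow> q' n = q n))"

lemma finite_use_computable:
  assumes "computable F" shows "finite_use F"
  unfolding finite_use_def
proof (intro allI impI)
  fix p q n assume F: "F p = Some q"
  obtain e where e: "F = functional e" using assms unfolding computable_def by blast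
  have run: "run e p' [n] = Some (q' n)" if "F p' = Some q'" for p' q'
    using that unfolding e functional_def by (auto split: if_splits)
  from run_finite_use[OF run[OF F]]
  show "\<forall>\<^sub>F N in sequentially. \<forall>p' q'. (\<forall>i<N. p' i = p i) \<longrightarrow> F p' = Some q' \<longrightarrow> q' n = q n"
    by eventually_elim (use run in fastforce)
qed

lemma finite_use_bind_join:
  assumes K: "finite_use K" and F: "finite_use F"
  shows "finite_use (\<lambda>p. Option.bind (K p) (\<lambda>r. F (join p r)))"
  unfolding finite_use_def
proof (intro allI impI)
  fix p q n assume "Option.bind (K p) (\<lambda>r. F (join p r)) = Some q"
  then obtain r where r: "K p = Some r" and q: "F (join p r) = Some q"
    by (auto simp: bind_eq_Some_conv)
  from F[unfolded finite_use_def, rule_format, OF q, of n]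
  obtain M where M: "\<forall>N\<ge>M. \<forall>h q'. (\<forall>i<N. h i = join p r i) \<longrightarrow> F h = Some q' \<longrightarrow> q' n = q n"
    unfolding eventually_sequentially ..
  have "\<forall>\<^sub>F N in sequentially. \<forall>m\<in>{..<M}. \<forall>p' r'. (\<forall>i<N. p' i = p i) \<longrightarrow> K p' = Some r' \<longrightarrow> r' m = r m"
    using K[unfolded finite_use_def, rule_format, OF r] by (intro eventually_ball_finite) simp_all
  with eventually_ge_at_top[of M]
  show "\<forall>\<^sub>F N in sequentially. \<forall>p' q'. (\<forall>i<N. p' i = p i) \<longrightarrow>
      Option.bind (K p') (\<lambda>r. F (join p' r)) = Some q' \<longrightarrow> q' n = q n"
  proof eventually_elim
    case (elim N)
    show ?case
    proof (intro allI impI)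
      fix p' q' assume p': "\<forall>i<N. p' i = p i"
        and "Option.bind (K p') (\<lambda>r. F (join p' r)) = Some q'"
      then obtain r' where r': "K p' = Some r'" and q': "F (join p' r') = Some q'"
        by (auto simp: bind_eq_Some_conv)
      have "join p' r' i = join p r i" if "i < M" for i
      proof -
        have "i div 2 < M" using that by simp
        then have "p' (i div 2) = p (i div 2)" "r' (i div 2) = r (i div 2)"
          using elim p' r' by auto
        then show ?thesis by (simp add: join_def)
      qed
      with M[rule_format, OF order_refl] q' show "q' n = q n" by blast
    qed
  qed
qed

text \<open>The solution for \<open>(I, 0)\<close> is approximated up to \<open>1 / 4\<close> after a prefix of length \<open>N\<close> of the input has
  been read. The input \<open>(I, e)\<close> with \<open>e = basis (Suc N)\<close> has a name with the same prefix, so the same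
  rational vector would be within \<open>1 / 4\<close> of both \<open>0\<close> and the unit vector \<open>e\<close>.\<close>

lemma no_finite_use_solver:
  assumes f: "\<And>m. m \<ge> 1 \<Longrightarrow> f m \<ge> m"
    and solves: "\<And>p A b. (A, b) \<in> Omega f \<Longrightarrow> input_rep p (A, b) \<Longrightarrow> \<exists>q. F p = Some q \<and> delta_H q (inv A b)"
  shows "\<not> finite_use F"
proof
  assume use: "finite_use F"
  let ?c = "\<lambda>n i. if i = n then pow_code 0 else 0"
  have solves': "\<exists>q. F (identity_name c) = Some q \<and> delta_H q b"
    if "\<And>i. coord b (Suc i) = of_real (rat_code (c i))" for c b
    using solves[OF id_in_Omega[OF f] input_rep_identity_name[OF that]] by (simp add: inv_id)
  obtain q where q: "F (identity_name (\<lambda>_. 0)) = Some q" "delta_H q 0"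
    using solves'[of 0 "\<lambda>_. 0"] by auto
  from use[unfolded finite_use_def, rule_format, OF q(1), of 2]
  obtain N where N: "\<forall>M\<ge>N. \<forall>p' q'. (\<forall>i<M. p' i = identity_name (\<lambda>_. 0) i) \<longrightarrow>
      F p' = Some q' \<longrightarrow> q' 2 = q 2"
    unfolding eventually_sequentially ..
  have "coord (basis (Suc N)) (Suc i) = of_real (rat_code (?c N i))" for i
    by (simp add: coord_basis)
  from solves'[OF this]
  obtain q' where q': "F (identity_name (?c N)) = Some q'" "delta_H q' (basis (Suc N))" by blast
  have "identity_name (?c N) i = identity_name (\<lambda>_. 0) i" if "i < N" for i
  proof -
    have "pfst (i div 2) < N" using that pfst_le[of "i div 2"] by linarith
    then show ?thesis by (simp add: identity_name_def)
  qed
  then have "q' 2 = q 2" using N[rule_format, OF order_refl] q'(1) by blast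
  then have "norm (rat_vec (q 2)) \<le> 1 / 4" "norm (rat_vec (q 2) - basis (Suc N)) \<le> 1 / 4"
    using q(2)[unfolded delta_H_def, rule_format, of 2]
      q'(2)[unfolded delta_H_def, rule_format, of 2] by simp_all
  moreover have "1 \<le> norm (basis (Suc N))"
    using cmod_coord_le_norm[of "basis (Suc N)" "Suc N"] by (simp add: coord_basis)
  ultimately show False
    using norm_triangle_sub[of "basis (Suc N)" "rat_vec (q 2)"] by (simp add: norm_minus_commute)
qed

text \<open>If \<open>F\<close> after \<open>K\<close> already outputs names of the solutions, the second half of the reduction only
  projects to the answer of the realizer.\<close>

lemma Solve_leI:
  assumes K: "computable K"
    and solves: "\<And>p A b. (A, b) \<in> Omega f \<Longrightarrow> input_rep p (A, b) \<Longrightarrow>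
      \<exists>q r. K p = Some q \<and> F q = Some r \<and> delta_H r (inv A b)"
  shows "Solve f \<le>\<^sub>W baire_problem F"
proof -
  let ?H = "\<lambda>p q. Some (odds (join p q))"
  have "realizes (\<lambda>p. Option.bind (K p) (\<lambda>q. Option.bind (G q) (?H p))) (Solve f)"
    if G: "realizes G (baire_problem F)" for G
    unfolding realizes_def
  proof (intro allI impI)
    fix p u assume *: "sols (Solve f) u \<noteq> {} \<and> in_rep (Solve f) p u"
    obtain A b where u: "u = (A, b)" by (cases u)
    from * u have dom: "(A, b) \<in> Omega f" "input_rep p (A, b)"
      by (auto simp: Solve_def split: if_splits)
    then obtain q r where r: "K p = Some q" "F q = Some r" "delta_H r (inv A b)"
      using solves by blast
    then have "G q = Some r"
      using G unfolding realizes_def baire_problem_def by force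
    with r dom show "\<exists>q v. Option.bind (K p) (\<lambda>q. Option.bind (G q) (?H p)) = Some q \<and>
        out_rep (Solve f) q v \<and> v \<in> sols (Solve f) u"
      by (simp add: Solve_def u odds_def)
  qed
  moreover have "computable2 ?H"
    unfolding computable2_def odds_def
    by (rule exI[of _ "\<lambda>p. Some (\<lambda>n. p (2 * n + 1))"])
      (intro conjI refl crec_computable crec_basic)
  ultimately show ?thesis using K unfolding weihrauch_le_def by blast
qed

lemma Inf_enat_eq_1:
  assumes "Q 1" "\<not> Q 0" shows "Inf {enat k |k. Q k} = 1"
proof (rule antisym)
  show "Inf {enat k |k. Q k} \<le> 1"
    using assms(1) by (intro Inf_lower) (auto simp: one_enat_def)
  show "1 \<le> Inf {enat k |k. Q k}"
  proof (rule Inf_greatest)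
    fix x assume "x \<in> {enat k |k. Q k}"
    then obtain k where "x = enat k" "Q k" by blast
    with assms(2) show "1 \<le> x" by (cases k) (auto simp: one_enat_def)
  qed
qed

theorem theorem2p4:
  fixes f :: "nat \<Rightarrow> nat"
  assumes "computable_nat_on {1..} f"
    and "\<And>m. m \<ge> 1 \<Longrightarrow> f m \<ge> m"
  shows "Solve f \<equiv>\<^sub>W baire_problem Lim_baire \<and>
    SCI_lim_Comp f = rk_lim (Solve f) \<and> rk_lim (Solve f) = 1"
proof -
  obtain e where "\<And>p n. n \<ge> 1 \<Longrightarrow> run e p [n] = Some (f n)"
    using assms(1) unfolding computable_nat_on_def by auto
  then have "crec (\<lambda>p x. f (Suc x))"
    by (intro crecI[of "Comp e [Succ]"]) simp
  then have f: "crec (\<lambda>p x. f (Suc (F p x)))" if "crec F" for F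
    using crec_comp1[of "\<lambda>p x. f (Suc x)" F] that by blast
  have K: "computable (\<lambda>p. Some (solver f p))"
    by (intro crec_computable crec_solver f)
  have Lim1: "Lim_pow 1 = Lim_baire"
    by (simp add: fun_eq_iff)
  have le: "Solve f \<le>\<^sub>W baire_problem Lim_baire"
    by (rule Solve_leI[OF K]) (use solver_correct in auto)
  \<comment> \<open>A reduction to the identity would be a solver of finite use, the realizer being \<open>Some\<close>.\<close>
  have "\<not> Solve f \<le>\<^sub>W baire_problem (Lim_pow 0)"
  proof
    assume "Solve f \<le>\<^sub>W baire_problem (Lim_pow 0)"
    then obtain K H where "computable K" "computable2 H" and
      R: "\<And>G. realizes G (baire_problem (Lim_pow 0)) \<Longrightarrow>
        realizes (\<lambda>p. Option.bind (K p) (\<lambda>q. Option.bind (G q) (H p))) (Solve f)"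
      unfolding weihrauch_le_def by blast
    then obtain F where F: "computable F" "H = (\<lambda>p q. F (join p q))"
      unfolding computable2_def by blast
    have "realizes Some (baire_problem (Lim_pow 0))"
      by (auto simp: realizes_def baire_problem_def)
    from R[OF this] have "realizes (\<lambda>p. Option.bind (K p) (\<lambda>r. F (join p r))) (Solve f)"
      by (simp add: F)
    then have "\<not> finite_use (\<lambda>p. Option.bind (K p) (\<lambda>r. F (join p r)))"
      by (intro no_finite_use_solver[OF assms(2)]) (force simp: realizes_def Solve_def)+
    with \<open>computable K\<close> F(1) show False
      by (blast intro: finite_use_bind_join finite_use_computable)
  qed
  then have rk: "rk_lim (Solve f) = 1"
    unfolding rk_lim_def using le by (intro Inf_enat_eq_1) (simp_all only: Lim1 not_False_eq_True)
  have "SCI_lim_Comp f = 1"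
    unfolding SCI_lim_Comp_def
  proof (rule Inf_enat_eq_1)
    show "\<exists>K. computable K \<and> (\<forall>p. \<forall>Ab\<in>Omega f. input_rep p Ab \<longrightarrow>
        (\<exists>q r. K p = Some q \<and> Lim_pow 1 q = Some r \<and> delta_H r (Xi Ab)))"
      unfolding Lim1 using K solver_correct by (intro exI[of _ "\<lambda>p. Some (solver f p)"]) fastforce
    show "\<not> (\<exists>K. computable K \<and> (\<forall>p. \<forall>Ab\<in>Omega f. input_rep p Ab \<longrightarrow>
        (\<exists>q r. K p = Some q \<and> Lim_pow 0 q = Some r \<and> delta_H r (Xi Ab))))"
    proof safe
      fix K assume "computable K" and "\<forall>p. \<forall>Ab\<in>Omega f. input_rep p Ab \<longrightarrow>
        (\<exists>q r. K p = Some q \<and> Lim_pow 0 q = Some r \<and> delta_H r (Xi Ab))"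
      then have "\<not> finite_use K"
        by (intro no_finite_use_solver[OF assms(2)]) fastforce+
      with \<open>computable K\<close> show False by (simp add: finite_use_computable)
    qed
  qed
  with rk le Lim_le_Solve[OF assms(2)] show ?thesis
    by (simp add: weihrauch_equiv_def)
qed

end
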